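(* Let $k$ be a field of characteristic $p>0$ and let $(\mathfrak g,[-,-],\blacktriangleright)$ be a post-Lie algebra over $k$. For every $x\in\mathfrak g$, the element $$L(x):=x^{\star_{\blacktriangleright}p}-x^{p}-x^{\bullet p}$$ of $\mathfrak u(\mathfrak g)$ (where $x^{\star_{\blacktriangleright}p}$ is the $p$-th power of $x$ for the product $\star_{\blacktriangleright}$ and $x^p$ is the $p$-th power of $x$ for the ordinary product of $\mathfrak u(\mathfrak g)$) belongs to $[\mathfrak g,\mathfrak g]$. Moreover, $$L(x)=\sum_{\substack{n\ge 2,\ \ell_1+\cdots+\ell_n=p,\\ \ell_i\ge 1,\ \exists j:\ \ell_j\ge 2}}\frac1n\,\frac{(p-1)!}{(\ell_1-1)!\cdots(\ell_n-1)!}\,\frac{1}{C_{\ell_1,\ldots,\ell_n}}\,[x^{\bullet\ell_1}\cdots x^{\bullet\ell_n}].$$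
   Context: A post-Lie algebra is a Lie algebra $(\mathfrak g,[-,-])$ over $k$ with a bilinear operation $\blacktriangleright:\mathfrak g\otimes\mathfrak g\to\mathfrak g$ such that for all $x,y,z\in\mathfrak g$: $x\blacktriangleright[y,z]=[x\blacktriangleright y,z]+[y,x\blacktriangleright z]$ and $[x,y]\blacktriangleright z=a_\blacktriangleright(x,y,z)-a_\blacktriangleright(y,x,z)$, where $a_\blacktriangleright(x,y,z)=x\blacktriangleright(y\blacktriangleright z)-(x\blacktriangleright y)\blacktriangleright z$. $\mathfrak u(\mathfrak g)$ is the universal enveloping algebra of $(\mathfrak g,[-,-])$ with its usual cocommutative Hopf algebra structure (elements of $\mathfrak g$ are primitive, counit $\varepsilon$, Sweedler notation $\Delta(E)=E_{(1)}\otimes E_{(2)}$). The operation $\blacktriangleright$ is extended to a bilinear operation on $\mathfrak u(\mathfrak g)$ by $1\blacktriangleright F=F$, $E\blacktriangleright 1=\varepsilon(E)1$, $(xE)\blacktriangleright F=x\blacktriangleright(E\blacktriangleright F)-(x\blacktriangleright E)\blacktriangleright F$, $E\blacktriangleright(F_1F_2)=(E_{(1)}\blacktriangleright F_1)(E_{(2)}\blacktriangleright F_2)$ for $x\in\mathfrak g$ and $E,F,F_1,F_2\in\mathfrak u(\mathfrak g)$. The associative product $\star_\blacktriangleright$ on $\mathfrak u(\mathfrak g)$ is $E\star_\blacktriangleright F=E_{(1)}(E_{(2)}\blacktriangleright F)$. Notation: $x^{\bullet 1}=x$, $x^{\bullet n}=x\blacktriangleright x^{\bullet(n-1)}$ for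 $n\ge 2$; $[x_1\cdots x_n]=[x_1,[x_2,\cdots[x_{n-1},x_n]\cdots]]$ is the right-iterated Lie bracket; $C_{\ell_1,\ldots,\ell_n}=\prod_{1\le v\le n-1}(\ell_1+\cdots+\ell_v)$ mod $p$. $[\mathfrak g,\mathfrak g]$ is the span of all brackets. *)

theory Defs
  imports "HOL-Algebra.QuotRing" "HOL-Algebra.Algebraic_Closure_Type"
    "HOL-Library.Poly_Mapping" "HOL-Library.Product_Plus"
begin

section \<open>Lie algebras and post-Lie algebras over a field\<close>

locale lie_algebra = vector_space scale
  for scale :: "'k::field \<Rightarrow> 'g::ab_group_add \<Rightarrow> 'g" +
  fixes br :: "'g \<Rightarrow> 'g \<Rightarrow> 'g"
  assumes br_linear_right: "Vector_Spaces.linear scale scale (\<lambda>y. br x y)"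
    and br_linear_left: "Vector_Spaces.linear scale scale (\<lambda>x. br x y)"
    and br_alternating: "br x x = 0"
    and jacobi: "br x (br y z) + br y (br z x) + br z (br x y) = 0"

definition associator :: "('g::ab_group_add \<Rightarrow> 'g \<Rightarrow> 'g) \<Rightarrow> 'g \<Rightarrow> 'g \<Rightarrow> 'g \<Rightarrow> 'g" where
  "associator tri x y z = tri x (tri y z) - tri (tri x y) z"

locale post_lie_algebra = lie_algebra scale br
  for scale :: "'k::field \<Rightarrow> 'g::ab_group_add \<Rightarrow> 'g" and br :: "'g \<Rightarrow> 'g \<Rightarrow> 'g" +
  fixes tri :: "'g \<Rightarrow> 'g \<Rightarrow> 'g"
  assumes tri_linear_right: "Vector_Spaces.linear scale scale (\<lambda>y. tri x y)"
    and tri_linear_left: "Vector_Spaces.linear scale scale (\<lambda>x. tri x y)"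
    and tri_br: "tri x (br y z) = br (tri x y) z + br y (tri x z)"
    and br_tri: "tri (br x y) z = associator tri x y z - associator tri y x z"

definition lie_derived ::
    "('k::field \<Rightarrow> 'g::ab_group_add \<Rightarrow> 'g) \<Rightarrow> ('g \<Rightarrow> 'g \<Rightarrow> 'g) \<Rightarrow> 'g set" where
  "lie_derived scale br = Modules.module.span scale {br y z | y z. True}"

text \<open>The value on the empty list is irrelevant.\<close>

fun iter_br :: "('g::zero \<Rightarrow> 'g \<Rightarrow> 'g) \<Rightarrow> 'g list \<Rightarrow> 'g" where
  "iter_br br [] = 0"
| "iter_br br [x] = x"
| "iter_br br (x # y # xs) = br x (iter_br br (y # xs))"

text \<open>\<open>x\<^sup>\<bullet>\<^sup>n\<close>, meaningful for \<open>n \<ge> 1\<close>.\<close>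

definition bullet_pow :: "('g \<Rightarrow> 'g \<Rightarrow> 'g) \<Rightarrow> 'g \<Rightarrow> nat \<Rightarrow> 'g" where
  "bullet_pow tri x n = (tri x ^^ (n - 1)) x"


section \<open>The free associative algebra\<close>

text \<open>The free monoid on \<open>'a\<close>, written additively so that \<open>'a word \<Rightarrow>\<^sub>0 'k\<close> is its monoid algebra,
  the free associative algebra on the set of elements of \<open>'a\<close>.\<close>

datatype 'a word = Word (letters: "'a list")

instantiation word :: (type) monoid_add
begin
definition zero_word :: "'a word" where "zero_word = Word []"
definition plus_word :: "'a word \<Rightarrow> 'a word \<Rightarrow> 'a word" where
  "plus_word u v = Word (letters u @ letters v)"
instance by standard (simp_all add: zero_word_def plus_word_def)
end

definition gen :: "'g \<Rightarrow> 'g word \<Rightarrow>\<^sub>0 'k::field" where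
  "gen x = Poly_Mapping.single (Word [x]) 1"

text \<open>The monoid algebra of \<open>'g word \<times> 'g word\<close> is the tensor square of \<open>'g word \<Rightarrow>\<^sub>0 'k\<close>;
  the basis element \<open>(u, v)\<close> is \<open>u \<otimes> v\<close>.\<close>

definition tens :: "('g word \<Rightarrow>\<^sub>0 'k::field) \<Rightarrow> ('g word \<Rightarrow>\<^sub>0 'k) \<Rightarrow> ('g word \<times> 'g word \<Rightarrow>\<^sub>0 'k)" where
  "tens s t = (\<Sum>u\<in>Poly_Mapping.keys s. \<Sum>v\<in>Poly_Mapping.keys t.
     Poly_Mapping.single (u, v) (Poly_Mapping.lookup s u * Poly_Mapping.lookup t v))"

text \<open>The algebra homomorphism sending each letter \<open>x\<close> to \<open>x \<otimes> 1 + 1 \<otimes> x\<close>.\<close>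

definition free_coprod :: "('g word \<Rightarrow>\<^sub>0 'k::field) \<Rightarrow> ('g word \<times> 'g word \<Rightarrow>\<^sub>0 'k)" where
  "free_coprod t = (\<Sum>w\<in>Poly_Mapping.keys t. Poly_Mapping.single 0 (Poly_Mapping.lookup t w) *
     prod_list (map (\<lambda>x. tens (gen x) 1 + tens 1 (gen x)) (letters w)))"

text \<open>The algebra homomorphism sending each letter to \<open>0\<close>.\<close>

definition free_counit :: "('g word \<Rightarrow>\<^sub>0 'k::field) \<Rightarrow> 'k" where
  "free_counit t = Poly_Mapping.lookup t 0"


section \<open>The universal enveloping algebra and its Hopf structure\<close>

text \<open>The first two families of relations cut the free algebra on the set of elements
  down to the tensor algebra of the vector space.\<close>

definition env_rels :: "('k::field \<Rightarrow> 'g::ab_group_add \<Rightarrow> 'g) \<Rightarrow> ('g \<Rightarrow> 'g \<Rightarrow> 'g) \<Rightarrow> ('g word \<Rightarrow>\<^sub>0 'k) set" where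
  "env_rels scale br =
     {gen (x + y) - gen x - gen y | x y. True} \<union>
     {gen (scale c x) - Poly_Mapping.single 0 c * gen x | c x. True} \<union>
     {gen x * gen y - gen y * gen x - gen (br x y) | x y. True}"

definition env_ideal :: "('k::field \<Rightarrow> 'g::ab_group_add \<Rightarrow> 'g) \<Rightarrow> ('g \<Rightarrow> 'g \<Rightarrow> 'g) \<Rightarrow> ('g word \<Rightarrow>\<^sub>0 'k) set" where
  "env_ideal scale br = Idl\<^bsub>ring_of_type_algebra\<^esub> (env_rels scale br)"

definition uenv :: "('k::field \<Rightarrow> 'g::ab_group_add \<Rightarrow> 'g) \<Rightarrow> ('g \<Rightarrow> 'g \<Rightarrow> 'g) \<Rightarrow> ('g word \<Rightarrow>\<^sub>0 'k) set ring" where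
  "uenv scale br = ring_of_type_algebra Quot (env_ideal scale br)"

definition uclass :: "('k::field \<Rightarrow> 'g::ab_group_add \<Rightarrow> 'g) \<Rightarrow> ('g \<Rightarrow> 'g \<Rightarrow> 'g) \<Rightarrow>
    ('g word \<Rightarrow>\<^sub>0 'k) \<Rightarrow> ('g word \<Rightarrow>\<^sub>0 'k) set" where
  "uclass scale br t = env_ideal scale br +>\<^bsub>ring_of_type_algebra\<^esub> t"

definition uincl :: "('k::field \<Rightarrow> 'g::ab_group_add \<Rightarrow> 'g) \<Rightarrow> ('g \<Rightarrow> 'g \<Rightarrow> 'g) \<Rightarrow>
    'g \<Rightarrow> ('g word \<Rightarrow>\<^sub>0 'k) set" where
  "uincl scale br x = uclass scale br (gen x)"

definition uscale :: "('k::field \<Rightarrow> 'g::ab_group_add \<Rightarrow> 'g) \<Rightarrow> ('g \<Rightarrow> 'g \<Rightarrow> 'g) \<Rightarrow>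
    'k \<Rightarrow> ('g word \<Rightarrow>\<^sub>0 'k) set \<Rightarrow> ('g word \<Rightarrow>\<^sub>0 'k) set" where
  "uscale scale br c E = uclass scale br (Poly_Mapping.single 0 c) \<otimes>\<^bsub>uenv scale br\<^esub> E"

text \<open>With \<open>T\<close> the free algebra and \<open>I\<close> the ideal of relations, \<open>T/I \<otimes> T/I\<close> is the quotient of
  \<open>T \<otimes> T\<close> by \<open>I \<otimes> T + T \<otimes> I\<close>, which is the ideal generated by \<open>I \<otimes> 1\<close> and \<open>1 \<otimes> I\<close>.\<close>

definition env_ideal2 :: "('k::field \<Rightarrow> 'g::ab_group_add \<Rightarrow> 'g) \<Rightarrow> ('g \<Rightarrow> 'g \<Rightarrow> 'g) \<Rightarrow>
    ('g word \<times> 'g word \<Rightarrow>\<^sub>0 'k) set" where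
  "env_ideal2 scale br = Idl\<^bsub>ring_of_type_algebra\<^esub>
     ((\<lambda>t. tens t 1) ` env_ideal scale br \<union> (\<lambda>t. tens 1 t) ` env_ideal scale br)"

definition uenv2 :: "('k::field \<Rightarrow> 'g::ab_group_add \<Rightarrow> 'g) \<Rightarrow> ('g \<Rightarrow> 'g \<Rightarrow> 'g) \<Rightarrow>
    ('g word \<times> 'g word \<Rightarrow>\<^sub>0 'k) set ring" where
  "uenv2 scale br = ring_of_type_algebra Quot (env_ideal2 scale br)"

definition uclass2 :: "('k::field \<Rightarrow> 'g::ab_group_add \<Rightarrow> 'g) \<Rightarrow> ('g \<Rightarrow> 'g \<Rightarrow> 'g) \<Rightarrow>
    ('g word \<times> 'g word \<Rightarrow>\<^sub>0 'k) \<Rightarrow> ('g word \<times> 'g word \<Rightarrow>\<^sub>0 'k) set" where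
  "uclass2 scale br s = env_ideal2 scale br +>\<^bsub>ring_of_type_algebra\<^esub> s"

text \<open>The maps induced on the quotient by \<open>free_coprod\<close> and \<open>free_counit\<close>; that the images below
  are singletons is part of the lemmas \<open>coprod_uclass\<close> and \<open>counit_uclass\<close>.\<close>

definition coprod :: "('k::field \<Rightarrow> 'g::ab_group_add \<Rightarrow> 'g) \<Rightarrow> ('g \<Rightarrow> 'g \<Rightarrow> 'g) \<Rightarrow>
    ('g word \<Rightarrow>\<^sub>0 'k) set \<Rightarrow> ('g word \<times> 'g word \<Rightarrow>\<^sub>0 'k) set" where
  "coprod scale br E = the_elem ((\<lambda>t. uclass2 scale br (free_coprod t)) ` E)"

definition counit :: "('g word \<Rightarrow>\<^sub>0 'k::field) set \<Rightarrow> 'k" where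
  "counit E = the_elem (free_counit ` E)"

definition lin_ext :: "('a \<Rightarrow> ('b::monoid_add \<Rightarrow>\<^sub>0 'k::field)) \<Rightarrow> ('a \<Rightarrow>\<^sub>0 'k) \<Rightarrow> ('b \<Rightarrow>\<^sub>0 'k)" where
  "lin_ext f t = (\<Sum>w\<in>Poly_Mapping.keys t. Poly_Mapping.single 0 (Poly_Mapping.lookup t w) * f w)"

lemma poly_mapping_sum_monomials:
  "(\<Sum>w\<in>Poly_Mapping.keys t. Poly_Mapping.single w (Poly_Mapping.lookup t w)) = t"
  by (rule poly_mapping_eqI) (simp add: lookup_sum lookup_single when_def in_keys_iff)

lemma single_0_central:
  fixes t :: "'b::monoid_add \<Rightarrow>\<^sub>0 'k::field"
  shows "t * Poly_Mapping.single 0 c = Poly_Mapping.single 0 c * t"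
proof -
  have "(\<Sum>w\<in>Poly_Mapping.keys t. Poly_Mapping.single w (Poly_Mapping.lookup t w)) * Poly_Mapping.single 0 c
      = Poly_Mapping.single 0 c * (\<Sum>w\<in>Poly_Mapping.keys t. Poly_Mapping.single w (Poly_Mapping.lookup t w))"
    by (simp add: sum_distrib_left sum_distrib_right mult_single mult.commute)
  then show ?thesis by (simp only: poly_mapping_sum_monomials)
qed

lemma lin_ext_superset:
  assumes "finite A" "Poly_Mapping.keys t \<subseteq> A"
  shows "lin_ext f t = (\<Sum>w\<in>A. Poly_Mapping.single 0 (Poly_Mapping.lookup t w) * f w)"
  unfolding lin_ext_def using assms
  by (intro sum.mono_neutral_left) (auto simp: in_keys_iff)

lemma lin_ext_add: "lin_ext f (s + t) = lin_ext f s + lin_ext f t"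
proof -
  let ?A = "Poly_Mapping.keys s \<union> Poly_Mapping.keys t"
  have "Poly_Mapping.keys (s + t) \<subseteq> ?A" by (rule Poly_Mapping.keys_add)
  then show ?thesis
    by (simp add: lin_ext_superset[of ?A] lookup_add single_add distrib_right sum.distrib)
qed

lemma lin_ext_zero [simp]: "lin_ext f 0 = 0"
  by (simp add: lin_ext_def)

lemma lin_ext_sum: "lin_ext f (sum g A) = (\<Sum>a\<in>A. lin_ext f (g a))"
  by (induction A rule: infinite_finite_induct) (simp_all add: lin_ext_add)

lemma lin_ext_uminus: "lin_ext f (- t) = - lin_ext f t"
  using lin_ext_add[of f t "- t"] by (simp add: eq_neg_iff_add_eq_0 add.commute)

lemma lin_ext_diff: "lin_ext f (s - t) = lin_ext f s - lin_ext f t"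
  using lin_ext_add[of f s "- t"] by (simp add: lin_ext_uminus)

lemma lin_ext_single: "lin_ext f (Poly_Mapping.single w c) = Poly_Mapping.single 0 c * f w"
  by (subst lin_ext_superset[of "{w}"]) simp_all

lemma lin_ext_mult:
  fixes f :: "'a::monoid_add \<Rightarrow> ('b::monoid_add \<Rightarrow>\<^sub>0 'k::field)"
  assumes f: "\<And>u v. f (u + v) = f u * f v"
  shows "lin_ext f (s * t) = lin_ext f s * lin_ext f t"
proof -
  let ?m = "\<lambda>t w. Poly_Mapping.single w (Poly_Mapping.lookup t w)"
  have "lin_ext f ((\<Sum>u\<in>Poly_Mapping.keys s. ?m s u) * (\<Sum>v\<in>Poly_Mapping.keys t. ?m t v))
      = lin_ext f (\<Sum>u\<in>Poly_Mapping.keys s. ?m s u) * lin_ext f (\<Sum>v\<in>Poly_Mapping.keys t. ?m t v)"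
  proof -
    have "lin_ext f (?m s u * ?m t v) = lin_ext f (?m s u) * lin_ext f (?m t v)" for u v
    proof -
      let ?a = "Poly_Mapping.lookup s u" and ?b = "Poly_Mapping.lookup t v"
      have "lin_ext f (?m s u * ?m t v)
          = (Poly_Mapping.single 0 ?a * Poly_Mapping.single 0 ?b) * (f u * f v)"
        by (simp add: mult_single lin_ext_single f)
      also have "\<dots> = Poly_Mapping.single 0 ?a * (Poly_Mapping.single 0 ?b * f u) * f v"
        by (simp only: mult.assoc)
      also have "\<dots> = Poly_Mapping.single 0 ?a * (f u * Poly_Mapping.single 0 ?b) * f v"
        by (simp only: single_0_central)
      finally show ?thesis by (simp add: lin_ext_single mult.assoc)
    qed
    then show ?thesis by (simp add: sum_product lin_ext_sum)
  qed
  then show ?thesis by (simp only: poly_mapping_sum_monomials)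
qed

lemma lin_ext_one: "f 0 = 1 \<Longrightarrow> lin_ext f 1 = 1"
  using lin_ext_single[of f 0 1] by simp

lemma lin_ext_scalar: "f 0 = 1 \<Longrightarrow> lin_ext f (Poly_Mapping.single 0 c) = Poly_Mapping.single 0 c"
  by (simp add: lin_ext_single)

lemma tens_1_right: "tens t 1 = lin_ext (\<lambda>w. Poly_Mapping.single (w, 0) 1) t"
  by (simp add: tens_def lin_ext_def mult_single zero_prod_def lookup_one)

lemma tens_1_left: "tens 1 t = lin_ext (\<lambda>w. Poly_Mapping.single (0, w) 1) t"
  by (simp add: tens_def lin_ext_def mult_single zero_prod_def lookup_one)

lemma free_coprod_lin_ext:
  "free_coprod = lin_ext (\<lambda>w. prod_list (map (\<lambda>x. tens (gen x) 1 + tens 1 (gen x)) (letters w)))"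
  by (rule ext) (simp add: free_coprod_def lin_ext_def)

lemma tens_commute: "tens s 1 * tens 1 t = tens 1 t * tens s 1"
proof -
  let ?m = "\<lambda>t w. Poly_Mapping.single w (Poly_Mapping.lookup t w)"
  have *: "tens (?m s u) 1 * tens 1 (?m t v) = tens 1 (?m t v) * tens (?m s u) 1" for u v
    by (simp add: tens_1_right tens_1_left lin_ext_single mult_single mult.commute)
  have "tens s 1 = (\<Sum>u\<in>Poly_Mapping.keys s. tens (?m s u) 1)"
    using lin_ext_sum[of "\<lambda>w. Poly_Mapping.single (w, 0) 1" "?m s" "Poly_Mapping.keys s"]
    by (simp only: poly_mapping_sum_monomials tens_1_right)
  moreover have "tens 1 t = (\<Sum>v\<in>Poly_Mapping.keys t. tens 1 (?m t v))"
    using lin_ext_sum[of "\<lambda>w. Poly_Mapping.single (0, w) 1" "?m t" "Poly_Mapping.keys t"]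
    by (simp only: poly_mapping_sum_monomials tens_1_left)
  ultimately show ?thesis
    by (simp only: sum_product *) (rule sum.swap)
qed

lemma free_coprod_hom:
  fixes s t :: "'g word \<Rightarrow>\<^sub>0 'k::field"
  shows "free_coprod (s + t) = free_coprod s + free_coprod t"
    and "free_coprod (s - t) = free_coprod s - free_coprod t"
    and "free_coprod (s * t) = free_coprod s * free_coprod t"
    and "free_coprod (1 :: 'g word \<Rightarrow>\<^sub>0 'k) = 1"
    and "free_coprod (Poly_Mapping.single (0 :: 'g word) c) = Poly_Mapping.single 0 c"
    and "free_coprod (gen x :: 'g word \<Rightarrow>\<^sub>0 'k) = tens (gen x) 1 + tens 1 (gen x)"
proof -
  show "free_coprod (s * t) = free_coprod s * free_coprod t"
    unfolding free_coprod_lin_ext by (rule lin_ext_mult) (simp add: plus_word_def)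
  show "free_coprod (gen x :: 'g word \<Rightarrow>\<^sub>0 'k) = tens (gen x) 1 + tens 1 (gen x)"
    unfolding free_coprod_lin_ext by (subst (1) gen_def) (simp add: lin_ext_single)
qed (simp_all add: free_coprod_lin_ext lin_ext_add lin_ext_diff lin_ext_one lin_ext_scalar
    zero_word_def[THEN arg_cong, of letters, simplified])

lemma free_counit_hom:
  fixes s t :: "'g word \<Rightarrow>\<^sub>0 'k::field"
  shows "free_counit (s + t) = free_counit s + free_counit t"
    and "free_counit (s - t) = free_counit s - free_counit t"
    and "free_counit (s * t) = free_counit s * free_counit t"
    and "free_counit (1 :: 'g word \<Rightarrow>\<^sub>0 'k) = 1"
    and "free_counit (gen x :: 'g word \<Rightarrow>\<^sub>0 'k) = 0"
proof -
  let ?m = "\<lambda>t w. Poly_Mapping.single w (Poly_Mapping.lookup t w)"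
  have sum_g: "free_counit (sum g A) = (\<Sum>a\<in>A. free_counit (g a))" for g :: "'g word \<Rightarrow> ('g word \<Rightarrow>\<^sub>0 'k)" and A
    by (simp add: free_counit_def lookup_sum)
  have zero: "u + v = 0 \<longleftrightarrow> u = 0 \<and> v = 0" for u v :: "'g word"
    by (cases u; cases v) (auto simp: plus_word_def zero_word_def)
  have "free_counit (?m s u * ?m t v) = free_counit (?m s u) * free_counit (?m t v)" for u v
    using zero[of u v] by (simp add: mult_single free_counit_def lookup_single when_def)
  then have "free_counit ((\<Sum>u\<in>Poly_Mapping.keys s. ?m s u) * (\<Sum>v\<in>Poly_Mapping.keys t. ?m t v))
      = free_counit (\<Sum>u\<in>Poly_Mapping.keys s. ?m s u) * free_counit (\<Sum>v\<in>Poly_Mapping.keys t. ?m t v)"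
    by (simp add: sum_product sum_g)
  then show "free_counit (s * t) = free_counit s * free_counit t"
    by (simp only: poly_mapping_sum_monomials)
qed (simp_all add: free_counit_def lookup_add lookup_minus lookup_one gen_def lookup_single
      zero_word_def when_def)

lemma ring_type: "ring (ring_of_type_algebra :: 'a::ring_1 ring)"
proof -
  have "\<exists>y. x + y = 0" for x :: 'a using add.right_inverse by blast
  then show ?thesis
    unfolding ring_of_type_algebra_def using add.right_inverse
    by unfold_locales (auto simp: algebra_simps Units_def)
qed

lemma
  shows carrier_type: "carrier (ring_of_type_algebra :: 'a::ring_1 ring) = UNIV"
    and mult_type: "x \<otimes>\<^bsub>ring_of_type_algebra\<^esub> (y::'a) = x * y"
    and add_type: "x \<oplus>\<^bsub>ring_of_type_algebra\<^esub> (y::'a) = x + y"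
    and one_type: "\<one>\<^bsub>ring_of_type_algebra\<^esub> = (1::'a)"
    and zero_type: "\<zero>\<^bsub>ring_of_type_algebra\<^esub> = (0::'a)"
  by (simp_all add: ring_of_type_algebra_def)

lemmas type_simps = carrier_type mult_type add_type one_type zero_type

lemma ideal_env: "ideal (env_ideal scale br) ring_of_type_algebra"
  unfolding env_ideal_def by (rule ring.genideal_ideal[OF ring_type]) (simp add: carrier_type)

lemma ideal_env2: "ideal (env_ideal2 scale br) ring_of_type_algebra"
  unfolding env_ideal2_def by (rule ring.genideal_ideal[OF ring_type]) (simp add: carrier_type)

lemma ring_uenv: "ring (uenv scale br)" and ring_uenv2: "ring (uenv2 scale br)"
  unfolding uenv_def uenv2_def
  by (rule ideal.quotient_is_ring[OF ideal_env], rule ideal.quotient_is_ring[OF ideal_env2])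

lemma uclass_hom: "uclass scale br \<in> ring_hom ring_of_type_algebra (uenv scale br)"
  unfolding uenv_def using ideal.rcos_ring_hom[OF ideal_env] by (simp add: uclass_def[abs_def])

lemma uclass2_hom: "uclass2 scale br \<in> ring_hom ring_of_type_algebra (uenv2 scale br)"
  unfolding uenv2_def using ideal.rcos_ring_hom[OF ideal_env2] by (simp add: uclass2_def[abs_def])

lemma ideal_type_closed:
  assumes "ideal I (ring_of_type_algebra :: 'a::ring_1 ring)"
  shows "a \<in> I \<Longrightarrow> b \<in> I \<Longrightarrow> a + b \<in> I" "a \<in> I \<Longrightarrow> x * a \<in> I" "a \<in> I \<Longrightarrow> a * x \<in> I" "0 \<in> I"
    "a \<in> I \<Longrightarrow> - a \<in> I" "a \<in> I \<Longrightarrow> b \<in> I \<Longrightarrow> a - b \<in> I"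
proof -
  interpret ideal I "ring_of_type_algebra :: 'a ring" by (rule assms)
  have 1: "a + b \<in> I" if "a \<in> I" "b \<in> I" for a b
    using additive_subgroup.a_closed[OF is_additive_subgroup that] by (simp add: add_type)
  have 2: "x * a \<in> I" if "a \<in> I" for a x
    using I_l_closed[OF that, of x] by (simp add: type_simps)
  show "a \<in> I \<Longrightarrow> b \<in> I \<Longrightarrow> a + b \<in> I" by (rule 1)
  show "a \<in> I \<Longrightarrow> x * a \<in> I" by (rule 2)
  show "a \<in> I \<Longrightarrow> a * x \<in> I" using I_r_closed[of a x] by (simp add: type_simps)
  show "0 \<in> I" using additive_subgroup.zero_closed[OF is_additive_subgroup] by (simp add: type_simps)
  show "a \<in> I \<Longrightarrow> - a \<in> I" using 2[of a "- 1"] by simp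
  show "a \<in> I \<Longrightarrow> b \<in> I \<Longrightarrow> a - b \<in> I" using 1[of a "- b"] 2[of b "- 1"] by simp
qed

lemma in_a_r_coset_type: "t \<in> I +>\<^bsub>ring_of_type_algebra\<^esub> s \<longleftrightarrow> t - s \<in> I"
  for s t :: "'a::ring_1"
  by (auto simp: a_r_coset_def' type_simps intro: bexI[of _ "t - s"])

lemma in_uclass_iff: "t \<in> uclass scale br s \<longleftrightarrow> t - s \<in> env_ideal scale br"
  by (simp add: uclass_def in_a_r_coset_type)

lemma uclass2_eqI: "s - t \<in> env_ideal2 scale br \<Longrightarrow> uclass2 scale br s = uclass2 scale br t"
proof -
  assume *: "s - t \<in> env_ideal2 scale br"
  have "r - s \<in> env_ideal2 scale br \<longleftrightarrow> r - t \<in> env_ideal2 scale br" for r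
    using ideal_type_closed(1)[OF ideal_env2 _ *, of "r - s"]
      ideal_type_closed(6)[OF ideal_env2 _ *, of "r - t"] by auto
  then show ?thesis by (auto simp: uclass2_def in_a_r_coset_type)
qed

lemma carrier_uenv: "carrier (uenv scale br) = range (uclass scale br)"
  by (auto simp: uenv_def FactRing_def A_RCOSETS_def' uclass_def carrier_type)

lemma env_ideal_vimage:
  fixes scale :: "'k::field \<Rightarrow> 'g::ab_group_add \<Rightarrow> 'g" and h :: "('g word \<Rightarrow>\<^sub>0 'k) \<Rightarrow> 'b::ring_1"
  assumes J: "ideal J (ring_of_type_algebra :: 'b ring)"
    and h: "\<And>s t. h (s + t) = h s + h t" "\<And>s t. h (s * t) = h s * h t" "h 1 = 1"
    and rels: "\<And>r. r \<in> env_rels scale br \<Longrightarrow> h r \<in> J"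
    and t: "t \<in> env_ideal scale br"
  shows "h t \<in> J"
proof -
  let ?R = "ring_of_type_algebra :: ('g word \<Rightarrow>\<^sub>0 'k) ring"
  let ?S = "ring_of_type_algebra :: 'b ring"
  have "h \<in> ring_hom ?R ?S"
    by (rule ring_hom_memI) (simp_all add: type_simps h)
  then have "ring_hom_ring ?R ?S h"
    by (intro ring_hom_ringI2 ring_type)
  from ring_hom_ring.ideal_vimage[OF this J]
  have "ideal {r \<in> carrier ?R. h r \<in> J} ?R" .
  moreover have "env_rels scale br \<subseteq> {r \<in> carrier ?R. h r \<in> J}"
    using rels by (auto simp: carrier_type)
  ultimately have "env_ideal scale br \<subseteq> {r \<in> carrier ?R. h r \<in> J}"
    unfolding env_ideal_def by (rule ring.genideal_minimal[OF ring_type])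
  with t show ?thesis by auto
qed

lemma env_rels_ideal: "env_rels scale br \<subseteq> env_ideal scale br"
  unfolding env_ideal_def by (rule ring.genideal_self[OF ring_type]) (simp add: carrier_type)

lemma tens_env_ideal2:
  assumes "t \<in> env_ideal scale br"
  shows "tens t 1 \<in> env_ideal2 scale br" "tens 1 t \<in> env_ideal2 scale br"
proof -
  have "(\<lambda>t. tens t 1) ` env_ideal scale br \<union> (\<lambda>t. tens 1 t) ` env_ideal scale br
      \<subseteq> env_ideal2 scale br"
    unfolding env_ideal2_def by (rule ring.genideal_self[OF ring_type]) (simp add: carrier_type)
  with assms show "tens t 1 \<in> env_ideal2 scale br" "tens 1 t \<in> env_ideal2 scale br" by auto
qed

lemma tens_hom:
  fixes s t :: "'g word \<Rightarrow>\<^sub>0 'k::field"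
  shows "tens (s - t) 1 = tens s 1 - tens t 1" "tens 1 (s - t) = tens 1 s - tens 1 t"
    "tens (s * t) 1 = tens s 1 * tens t 1" "tens 1 (s * t) = tens 1 s * tens 1 t"
    "tens (Poly_Mapping.single 0 c) 1 = (Poly_Mapping.single 0 c :: 'g word \<times> 'g word \<Rightarrow>\<^sub>0 'k)"
    "tens 1 (Poly_Mapping.single 0 c) = (Poly_Mapping.single 0 c :: 'g word \<times> 'g word \<Rightarrow>\<^sub>0 'k)"
  unfolding tens_1_right tens_1_left
  by (simp_all add: lin_ext_diff lin_ext_mult lin_ext_single mult_single zero_prod_def)

lemma free_coprod_rels:
  assumes "r \<in> env_rels scale br"
  shows "free_coprod r = tens r 1 + tens 1 r"
proof -
  consider x y where "r = gen (x + y) - gen x - gen y"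
    | c x where "r = gen (scale c x) - Poly_Mapping.single 0 c * gen x"
    | x y where "r = gen x * gen y - gen y * gen x - gen (br x y)"
    using assms unfolding env_rels_def by blast
  then show ?thesis
    by cases (simp_all add: free_coprod_hom tens_hom distrib_left distrib_right tens_commute)
qed

lemma free_coprod_ideal: "t \<in> env_ideal scale br \<Longrightarrow> free_coprod t \<in> env_ideal2 scale br"
proof (rule env_ideal_vimage[OF ideal_env2, where h = free_coprod])
  fix r assume r: "r \<in> env_rels scale br"
  with env_rels_ideal have "r \<in> env_ideal scale br" by blast
  then show "free_coprod r \<in> env_ideal2 scale br"
    unfolding free_coprod_rels[OF r] by (intro ideal_type_closed(1)[OF ideal_env2] tens_env_ideal2)
qed (simp_all add: free_coprod_hom)

lemma free_counit_ideal:
  assumes "t \<in> env_ideal scale br"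
  shows "free_counit t = 0"
proof -
  have *: "ideal {0::'k::field} ring_of_type_algebra"
    using ring.zeroideal[OF ring_type, where ?'a1='k] by (simp add: type_simps)
  have rels: "free_counit r \<in> {0}" if "r \<in> env_rels scale br" for r
    using that by (auto simp: env_rels_def free_counit_hom)
  have "free_counit t \<in> {0}"
    by (rule env_ideal_vimage[OF * free_counit_hom(1) free_counit_hom(3) free_counit_hom(4) rels assms])
  then show ?thesis by simp
qed

lemma coprod_uclass: "coprod scale br (uclass scale br t) = uclass2 scale br (free_coprod t)"
proof -
  have "uclass2 scale br (free_coprod s) = uclass2 scale br (free_coprod t)"
    if "s \<in> uclass scale br t" for s
    using free_coprod_ideal[of "s - t"] that
    by (intro uclass2_eqI) (simp add: in_uclass_iff free_coprod_hom)
  moreover have "t \<in> uclass scale br t"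
    by (simp add: in_uclass_iff ideal_type_closed(4)[OF ideal_env])
  ultimately have "(\<lambda>s. uclass2 scale br (free_coprod s)) ` uclass scale br t
      = {uclass2 scale br (free_coprod t)}"
    by blast
  then show ?thesis by (simp add: coprod_def)
qed

lemma counit_uclass: "counit (uclass scale br t) = free_counit t"
proof -
  have "free_counit s = free_counit t" if "s \<in> uclass scale br t" for s
    using free_counit_ideal[of "s - t"] that by (simp add: in_uclass_iff free_counit_hom)
  moreover have "t \<in> uclass scale br t"
    by (simp add: in_uclass_iff ideal_type_closed(4)[OF ideal_env])
  ultimately have "free_counit ` uclass scale br t = {free_counit t}" by blast
  then show ?thesis by (simp add: counit_def)
qed

lemma coprod_hom: "coprod scale br \<in> ring_hom (uenv scale br) (uenv2 scale br)"
proof (rule ring_hom_memI)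
  fix E F assume "E \<in> carrier (uenv scale br)" "F \<in> carrier (uenv scale br)"
  then obtain s t where E: "E = uclass scale br s" and F: "F = uclass scale br t"
    by (auto simp: carrier_uenv)
  have "E \<otimes>\<^bsub>uenv scale br\<^esub> F = uclass scale br (s * t)"
    using ring_hom_mult[OF uclass_hom, of s t scale br] by (simp add: E F type_simps)
  moreover have "uclass2 scale br (free_coprod (s * t)) =
      uclass2 scale br (free_coprod s) \<otimes>\<^bsub>uenv2 scale br\<^esub> uclass2 scale br (free_coprod t)"
    using ring_hom_mult[OF uclass2_hom, of "free_coprod s" "free_coprod t" scale br]
    by (simp add: free_coprod_hom type_simps)
  ultimately show "coprod scale br (E \<otimes>\<^bsub>uenv scale br\<^esub> F) =
      coprod scale br E \<otimes>\<^bsub>uenv2 scale br\<^esub> coprod scale br F"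
    by (simp add: E F coprod_uclass)
  have "E \<oplus>\<^bsub>uenv scale br\<^esub> F = uclass scale br (s + t)"
    using ring_hom_add[OF uclass_hom, of s t scale br] by (simp add: E F type_simps)
  moreover have "uclass2 scale br (free_coprod (s + t)) =
      uclass2 scale br (free_coprod s) \<oplus>\<^bsub>uenv2 scale br\<^esub> uclass2 scale br (free_coprod t)"
    using ring_hom_add[OF uclass2_hom, of "free_coprod s" "free_coprod t" scale br]
    by (simp add: free_coprod_hom type_simps)
  ultimately show "coprod scale br (E \<oplus>\<^bsub>uenv scale br\<^esub> F) =
      coprod scale br E \<oplus>\<^bsub>uenv2 scale br\<^esub> coprod scale br F"
    by (simp add: E F coprod_uclass)
next
  fix E assume "E \<in> carrier (uenv scale br)"
  then show "coprod scale br E \<in> carrier (uenv2 scale br)"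
    by (auto simp: carrier_uenv coprod_uclass carrier_type intro!: ring_hom_closed[OF uclass2_hom])
next
  show "coprod scale br \<one>\<^bsub>uenv scale br\<^esub> = \<one>\<^bsub>uenv2 scale br\<^esub>"
    using ring_hom_one[OF uclass_hom, of scale br] ring_hom_one[OF uclass2_hom, of scale br]
    by (metis coprod_uclass free_coprod_hom(4) one_type)
qed

lemma coprod_uincl:
  "coprod scale br (uincl scale br x) = uclass2 scale br (tens (gen x) 1 + tens 1 (gen x))"
  by (simp add: uincl_def coprod_uclass free_coprod_hom)

lemma counit_uincl: "counit (uincl scale br x) = 0"
  by (simp add: uincl_def counit_uclass free_counit_hom)

text \<open>\<open>sweedler scale br B E\<close> is \<open>B(E\<^sub>(\<^sub>1\<^sub>), E\<^sub>(\<^sub>2\<^sub>))\<close>. For bilinear \<open>B\<close> it does not depend on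
  the chosen representative of the coproduct in the tensor square.\<close>

definition sweedler :: "('k::field \<Rightarrow> 'g::ab_group_add \<Rightarrow> 'g) \<Rightarrow> ('g \<Rightarrow> 'g \<Rightarrow> 'g) \<Rightarrow>
    (('g word \<Rightarrow>\<^sub>0 'k) set \<Rightarrow> ('g word \<Rightarrow>\<^sub>0 'k) set \<Rightarrow> ('g word \<Rightarrow>\<^sub>0 'k) set) \<Rightarrow>
    ('g word \<Rightarrow>\<^sub>0 'k) set \<Rightarrow> ('g word \<Rightarrow>\<^sub>0 'k) set" where
  "sweedler scale br B E = (let s = (SOME s. s \<in> coprod scale br E) in
     finsum (uenv scale br)
       (\<lambda>(u, v). uscale scale br (Poly_Mapping.lookup s (u, v))
          (B (uclass scale br (Poly_Mapping.single u 1)) (uclass scale br (Poly_Mapping.single v 1))))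
       (Poly_Mapping.keys s))"


section \<open>The extension of the post-Lie operation and the product star\<close>

definition u_bilinear :: "('k::field \<Rightarrow> 'g::ab_group_add \<Rightarrow> 'g) \<Rightarrow> ('g \<Rightarrow> 'g \<Rightarrow> 'g) \<Rightarrow>
    (('g word \<Rightarrow>\<^sub>0 'k) set \<Rightarrow> ('g word \<Rightarrow>\<^sub>0 'k) set \<Rightarrow> ('g word \<Rightarrow>\<^sub>0 'k) set) \<Rightarrow> bool" where
  "u_bilinear scale br B \<longleftrightarrow> (let U = uenv scale br; sc = uscale scale br in
     (\<forall>E\<in>carrier U. \<forall>F\<in>carrier U. B E F \<in> carrier U) \<and>
     (\<forall>E\<in>carrier U. \<forall>E'\<in>carrier U. \<forall>F\<in>carrier U. B (E \<oplus>\<^bsub>U\<^esub> E') F = B E F \<oplus>\<^bsub>U\<^esub> B E' F) \<and>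
     (\<forall>E\<in>carrier U. \<forall>F\<in>carrier U. \<forall>F'\<in>carrier U. B E (F \<oplus>\<^bsub>U\<^esub> F') = B E F \<oplus>\<^bsub>U\<^esub> B E F') \<and>
     (\<forall>c. \<forall>E\<in>carrier U. \<forall>F\<in>carrier U. B (sc c E) F = sc c (B E F)) \<and>
     (\<forall>c. \<forall>E\<in>carrier U. \<forall>F\<in>carrier U. B E (sc c F) = sc c (B E F)))"

text \<open>For a post-Lie algebra there is exactly one such operation on the carrier of \<open>uenv\<close>;
  its values outside the carrier are irrelevant.\<close>

definition post_lie_extension :: "('k::field \<Rightarrow> 'g::ab_group_add \<Rightarrow> 'g) \<Rightarrow> ('g \<Rightarrow> 'g \<Rightarrow> 'g) \<Rightarrow>
    ('g \<Rightarrow> 'g \<Rightarrow> 'g) \<Rightarrow>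
    (('g word \<Rightarrow>\<^sub>0 'k) set \<Rightarrow> ('g word \<Rightarrow>\<^sub>0 'k) set \<Rightarrow> ('g word \<Rightarrow>\<^sub>0 'k) set) \<Rightarrow> bool" where
  "post_lie_extension scale br tri utri \<longleftrightarrow>
    (let U = uenv scale br; i = uincl scale br in
     u_bilinear scale br utri \<and>
     (\<forall>x y. utri (i x) (i y) = i (tri x y)) \<and>
     (\<forall>F\<in>carrier U. utri \<one>\<^bsub>U\<^esub> F = F) \<and>
     (\<forall>E\<in>carrier U. utri E \<one>\<^bsub>U\<^esub> = uscale scale br (counit E) \<one>\<^bsub>U\<^esub>) \<and>
     (\<forall>x. \<forall>E\<in>carrier U. \<forall>F\<in>carrier U.
        utri (i x \<otimes>\<^bsub>U\<^esub> E) F = utri (i x) (utri E F) \<ominus>\<^bsub>U\<^esub> utri (utri (i x) E) F) \<and>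
     (\<forall>E\<in>carrier U. \<forall>F1\<in>carrier U. \<forall>F2\<in>carrier U.
        utri E (F1 \<otimes>\<^bsub>U\<^esub> F2) = sweedler scale br (\<lambda>E1 E2. utri E1 F1 \<otimes>\<^bsub>U\<^esub> utri E2 F2) E))"

definition star :: "('k::field \<Rightarrow> 'g::ab_group_add \<Rightarrow> 'g) \<Rightarrow> ('g \<Rightarrow> 'g \<Rightarrow> 'g) \<Rightarrow>
    (('g word \<Rightarrow>\<^sub>0 'k) set \<Rightarrow> ('g word \<Rightarrow>\<^sub>0 'k) set \<Rightarrow> ('g word \<Rightarrow>\<^sub>0 'k) set) \<Rightarrow>
    ('g word \<Rightarrow>\<^sub>0 'k) set \<Rightarrow> ('g word \<Rightarrow>\<^sub>0 'k) set \<Rightarrow> ('g word \<Rightarrow>\<^sub>0 'k) set" where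
  "star scale br utri E F = sweedler scale br (\<lambda>E1 E2. E1 \<otimes>\<^bsub>uenv scale br\<^esub> utri E2 F) E"

text \<open>The product \<open>star\<close> is associative with unit \<open>\<one>\<close>; powers are bracketed to the right.\<close>

definition star_pow :: "('k::field \<Rightarrow> 'g::ab_group_add \<Rightarrow> 'g) \<Rightarrow> ('g \<Rightarrow> 'g \<Rightarrow> 'g) \<Rightarrow>
    (('g word \<Rightarrow>\<^sub>0 'k) set \<Rightarrow> ('g word \<Rightarrow>\<^sub>0 'k) set \<Rightarrow> ('g word \<Rightarrow>\<^sub>0 'k) set) \<Rightarrow>
    ('g word \<Rightarrow>\<^sub>0 'k) set \<Rightarrow> nat \<Rightarrow> ('g word \<Rightarrow>\<^sub>0 'k) set" where
  "star_pow scale br utri E n = (star scale br utri E ^^ n) \<one>\<^bsub>uenv scale br\<^esub>"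

definition L_elem :: "('k::field \<Rightarrow> 'g::ab_group_add \<Rightarrow> 'g) \<Rightarrow> ('g \<Rightarrow> 'g \<Rightarrow> 'g) \<Rightarrow> ('g \<Rightarrow> 'g \<Rightarrow> 'g) \<Rightarrow>
    (('g word \<Rightarrow>\<^sub>0 'k) set \<Rightarrow> ('g word \<Rightarrow>\<^sub>0 'k) set \<Rightarrow> ('g word \<Rightarrow>\<^sub>0 'k) set) \<Rightarrow>
    nat \<Rightarrow> 'g \<Rightarrow> ('g word \<Rightarrow>\<^sub>0 'k) set" where
  "L_elem scale br tri utri p x =
     star_pow scale br utri (uincl scale br x) p
       \<ominus>\<^bsub>uenv scale br\<^esub> (uincl scale br x [^]\<^bsub>uenv scale br\<^esub> p)
       \<ominus>\<^bsub>uenv scale br\<^esub> uincl scale br (bullet_pow tri x p)"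


section \<open>The coefficients of the formula\<close>

definition C_coeff :: "nat list \<Rightarrow> 'k::field" where
  "C_coeff ls = (\<Prod>v = 1..length ls - 1. of_nat (sum_list (take v ls)))"

definition L_index :: "nat \<Rightarrow> nat list set" where
  "L_index p = {ls. length ls \<ge> 2 \<and> sum_list ls = p \<and> (\<forall>l\<in>set ls. l \<ge> 1) \<and> (\<exists>l\<in>set ls. l \<ge> 2)}"

definition L_coeff :: "nat \<Rightarrow> nat list \<Rightarrow> 'k::field" where
  "L_coeff p ls = 1 / of_nat (length ls)
     * (of_nat (fact (p - 1)) / prod_list (map (\<lambda>l. of_nat (fact (l - 1))) ls))
     * (1 / C_coeff ls)"

end

theory Submission
  imports Defs "HOL-Computational_Algebra.Formal_Power_Series"
begin

text \<open>On the enveloping algebra \<open>D = x \<triangleright> -\<close> is a derivation and \<open>x \<star> F = x F + D F\<close>, so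
  \<open>x\<^sup>\<star>\<^sup>m = Y\<^sub>m\<close> with \<open>Y\<^sub>m\<^sub>+\<^sub>1 = a Y\<^sub>m + D Y\<^sub>m\<close>, \<open>Y\<^sub>0 = 1\<close>, \<open>a = x\<close>. For a derivation \<open>E\<close> commuting with \<open>D\<close> let
  \<open>Z\<^sub>0 = 0\<close>, \<open>Z\<^sub>1 = E a\<close>, \<open>Z\<^sub>m\<^sub>+\<^sub>1 = [a, Z\<^sub>m] + D Z\<^sub>m\<close>. Then \<open>\<Sum>\<^sub>i (m choose i) Z\<^sub>i Y\<^sub>m\<^sub>-\<^sub>i = E Y\<^sub>m\<close>, which collapses
  to \<open>Z\<^sub>p = E Y\<^sub>p\<close> in characteristic \<open>p\<close>. Replace \<open>a\<close> by \<open>a X\<close> for a central variable \<open>X\<close> and take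
  \<open>E = X d/dX\<close>: the component of degree \<open>n\<close> of \<open>Y\<^sub>p\<close> becomes \<open>1/n\<close> times that of \<open>Z\<^sub>p\<close>, a combination of
  iterated commutators of the \<open>D\<^sup>l\<^sup>-\<^sup>1 a\<close>. The components of degree \<open>1\<close> and \<open>p\<close> are \<open>D\<^sup>p\<^sup>-\<^sup>1 a\<close> and \<open>a\<^sup>p\<close>.
  The computation takes place in the free algebra, to which \<open>D\<close> lifts.\<close>


section \<open>Powers of \<open>a + D\<close> for a derivation \<open>D\<close>\<close>

locale ring_derivation =
  fixes d :: "'a::ring_1 \<Rightarrow> 'a"
  assumes add: "d (s + t) = d s + d t"
    and mult: "d (s * t) = d s * t + s * d t"
begin

lemma zero: "d 0 = 0"
  using add[of 0 0] by simp

lemma one: "d 1 = 0"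
  using mult[of 1 1] by simp

lemma diff: "d (s - t) = d s - d t"
  using add[of "s - t" t] by simp

lemma sum: "d (sum f A) = (\<Sum>i\<in>A. d (f i))"
  by (induction A rule: infinite_finite_induct) (simp_all add: zero add)

lemma of_nat: "d (of_nat n) = 0"
  by (induction n) (simp_all add: zero one add)

end

text \<open>Pascal's rule, arranged so that each \<open>k\<close> up to \<open>m\<close> feeds
  \<open>g k\<close> and \<open>g (Suc k)\<close>. This is the shape of one Leibniz step on a
  binomial sum.\<close>

lemma sum_binomial_Suc:
  fixes g :: "nat \<Rightarrow> 'a::ring_1"
  shows "(\<Sum>k\<le>Suc m. of_nat (Suc m choose k) * g k)
    = (\<Sum>k\<le>m. of_nat (m choose k) * (g (Suc k) + g k))"
proof -
  have "(\<Sum>k\<le>Suc m. of_nat (Suc m choose k) * g k)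
      = g 0 + (\<Sum>k\<le>m. of_nat (m choose k) * g (Suc k)) + (\<Sum>k\<le>m. of_nat (m choose Suc k) * g (Suc k))"
    by (simp add: sum.atMost_Suc_shift distrib_right sum.distrib del: sum.atMost_Suc)
  also have "g 0 + (\<Sum>k\<le>m. of_nat (m choose Suc k) * g (Suc k)) = (\<Sum>k\<le>Suc m. of_nat (m choose k) * g k)"
    by (simp add: sum.atMost_Suc_shift del: sum.atMost_Suc)
  then have "g 0 + (\<Sum>k\<le>m. of_nat (m choose k) * g (Suc k)) + (\<Sum>k\<le>m. of_nat (m choose Suc k) * g (Suc k))
     = (\<Sum>k\<le>m. of_nat (m choose k) * g (Suc k)) + (\<Sum>k\<le>m. of_nat (m choose k) * g k)"
    by (simp add: add_ac binomial_eq_0)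
  finally show ?thesis by (simp add: distrib_left sum.distrib)
qed

lemma mult_of_nat_left_commute: "(x::'a::semiring_1) * (of_nat n * y) = of_nat n * (x * y)"
  by (metis mult.assoc mult_of_nat_commute)

definition deriv_pow :: "('a::ring_1 \<Rightarrow> 'a) \<Rightarrow> 'a \<Rightarrow> nat \<Rightarrow> 'a" where
  "deriv_pow D a m = ((\<lambda>t. a * t + D t) ^^ m) 1"

text \<open>The sequence \<open>Z\<close>, with \<open>b\<close> in place of \<open>E a\<close>.
  Starting from \<open>0\<close> and adding \<open>b\<close> only at the first step gives
  \<open>Z_1 = b\<close> for additive \<open>D\<close>, and makes the index \<open>0\<close> term of
  the binomial sum vanish.\<close>

primrec lie_pow :: "('a::ring_1 \<Rightarrow> 'a) \<Rightarrow> 'a \<Rightarrow> 'a \<Rightarrow> nat \<Rightarrow> 'a" where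
  "lie_pow D a b 0 = 0"
| "lie_pow D a b (Suc m) = a * lie_pow D a b m - lie_pow D a b m * a + D (lie_pow D a b m)
     + (if m = 0 then b else 0)"

lemma deriv_pow_0: "deriv_pow D a 0 = 1"
  and deriv_pow_Suc: "deriv_pow D a (Suc m) = a * deriv_pow D a m + D (deriv_pow D a m)"
  by (simp_all add: deriv_pow_def)

text \<open>Both sides start at \<open>0\<close> and satisfy
  \<open>W_(m+1) = a W_m + D W_m + (E a) Y_m\<close>: the right side because \<open>E\<close> is a
  derivation commuting with \<open>D\<close>, the left side by Pascal's rule.\<close>

lemma sum_lie_pow_deriv_pow:
  assumes "ring_derivation D" "ring_derivation E" and comm: "\<And>t. D (E t) = E (D t)"
  shows "(\<Sum>i\<le>m. of_nat (m choose i) * (lie_pow D a (E a) i * deriv_pow D a (m - i)))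
    = E (deriv_pow D a m)"
proof -
  interpret D: ring_derivation D by fact
  interpret E: ring_derivation E by fact
  let ?Y = "deriv_pow D a" and ?Z = "lie_pow D a (E a)"
  show ?thesis
  proof (induction m)
    case 0
    then show ?case by (simp add: deriv_pow_0 E.one)
  next
    case (Suc m)
    let ?W = "\<Sum>i\<le>m. of_nat (m choose i) * (?Z i * ?Y (m - i))"
    have "(\<Sum>i\<le>Suc m. of_nat (Suc m choose i) * (?Z i * ?Y (Suc m - i)))
      = (\<Sum>i\<le>m. of_nat (m choose i) * (?Z (Suc i) * ?Y (m - i) + ?Z i * ?Y (Suc (m - i))))"
      by (subst sum_binomial_Suc) (simp add: Suc_diff_le)
    \<comment> \<open>The part \<open>- Z_i a Y\<close> of the commutator cancels against
      \<open>Z_i (a Y)\<close>, and the two remaining \<open>D\<close> terms form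
      \<open>D (Z_i Y)\<close>. The value \<open>b = E a\<close> enters at \<open>i = 0\<close>
      only.\<close>
    also have "\<dots> = (\<Sum>i\<le>m. a * (of_nat (m choose i) * (?Z i * ?Y (m - i)))
        + D (of_nat (m choose i) * (?Z i * ?Y (m - i))) + (if i = 0 then E a * ?Y m else 0))"
      by (intro sum.cong refl)
        (auto simp: deriv_pow_Suc D.mult D.of_nat distrib_left distrib_right left_diff_distrib
          right_diff_distrib mult_of_nat_left_commute mult.assoc)
    also have "\<dots> = a * ?W + D ?W + E a * ?Y m"
      by (simp add: sum.distrib D.sum sum_distrib_left)
    also have "\<dots> = E (?Y (Suc m))"
      by (simp add: Suc.IH deriv_pow_Suc E.mult E.add comm algebra_simps)
    finally show ?case .
  qed
qed

text \<open>The prime \<open>p\<close> divides every binomial coefficient strictly between the ends,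
  and \<open>Z_0 = 0\<close>; only \<open>i = p\<close> survives, where
  \<open>Y_0 = 1\<close>.\<close>

lemma lie_pow_char:
  fixes a :: "'a::ring_1"
  assumes "ring_derivation D" "ring_derivation E" "\<And>t. D (E t) = E (D t)"
    and p: "prime p" "of_nat p = (0::'a)"
  shows "lie_pow D a (E a) p = E (deriv_pow D a p)"
proof -
  have "of_nat (p choose i) * (lie_pow D a (E a) i * deriv_pow D a (p - i)) = 0"
    if "i \<in> {..p} - {p}" for i
  proof (cases "i = 0")
    case False
    then have "p dvd p choose i"
      using that p(1) by (intro dvd_choose_prime) (auto simp: prime_gt_0_nat)
    then show ?thesis using p(2) by (auto elim!: dvdE)
  qed simp
  then have "(\<Sum>i\<le>p. of_nat (p choose i) * (lie_pow D a (E a) i * deriv_pow D a (p - i)))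
     = (\<Sum>i\<in>{p}. of_nat (p choose i) * (lie_pow D a (E a) i * deriv_pow D a (p - i)))"
    by (intro sum.mono_neutral_right) auto
  then show ?thesis
    using sum_lie_pow_deriv_pow[OF assms(1-3), of p a] by (simp add: deriv_pow_0)
qed

section \<open>Two derivations of the power series ring\<close>

lemma ring_derivation_fps:
  assumes "ring_derivation D"
  shows "ring_derivation (\<lambda>f. Abs_fps (\<lambda>n. D (fps_nth f n)))"
proof -
  interpret D: ring_derivation D by fact
  show ?thesis
    by standard (simp_all add: fps_eq_iff fps_mult_nth D.add D.mult D.sum sum.distrib)
qed

text \<open>The Euler operator \<open>X d/dX\<close>, which multiplies degree \<open>n\<close> by
  \<open>n\<close>. It plays the role of \<open>E\<close>; it commutes with the coefficientwise
  \<open>D\<close> because derivations kill integers.\<close>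

lemma ring_derivation_fps_degree:
  "ring_derivation (\<lambda>f :: 'a::ring_1 fps. Abs_fps (\<lambda>n. of_nat n * fps_nth f n))"
proof
  fix f g :: "'a fps"
  have "(\<Sum>i=0..n. of_nat n * (fps_nth f i * fps_nth g (n - i)))
      = (\<Sum>i=0..n. of_nat i * fps_nth f i * fps_nth g (n - i)
          + fps_nth f i * (of_nat (n - i) * fps_nth g (n - i)))" for n
  proof (intro sum.cong refl)
    fix i assume "i \<in> {0..n}"
    then have "of_nat n = (of_nat i + of_nat (n - i) :: 'a)" by (simp flip: of_nat_add)
    then show "of_nat n * (fps_nth f i * fps_nth g (n - i)) = of_nat i * fps_nth f i * fps_nth g (n - i)
          + fps_nth f i * (of_nat (n - i) * fps_nth g (n - i))"
      by (simp add: distrib_right mult_of_nat_left_commute mult.assoc)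
  qed
  then show "Abs_fps (\<lambda>n. of_nat n * fps_nth (f * g) n)
      = Abs_fps (\<lambda>n. of_nat n * fps_nth f n) * g + f * Abs_fps (\<lambda>n. of_nat n * fps_nth g n)"
    by (simp add: fps_eq_iff fps_mult_nth sum_distrib_left sum.distrib)
qed (simp add: fps_eq_iff distrib_left)


section \<open>Expansion over compositions\<close>

definition compositions :: "nat \<Rightarrow> nat \<Rightarrow> nat list set" where
  "compositions n m = {ls. length ls = n \<and> sum_list ls = m \<and> (\<forall>l\<in>set ls. l \<ge> 1)}"

text \<open>The coefficient of \<open>a\<^sub>1 \<cdots> a\<^sub>n\<close>, \<open>a\<^sub>i = D\<^sup>l a\<close> with \<open>l = \<ell>\<^sub>i - 1\<close>, in \<open>Y\<^sub>m\<close>, obtained by iterating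
  \<open>Y\<^sub>m = \<Sum>\<^sub>l (m - 1 choose l - 1) Y\<^sub>m\<^sub>-\<^sub>l D\<^sup>l\<^sup>-\<^sup>1 a\<close>.\<close>

definition bell_coeff :: "nat list \<Rightarrow> nat" where
  "bell_coeff ls = (\<Prod>i<length ls. (sum_list (take (Suc i) ls) - 1) choose (ls ! i - 1))"

text \<open>With \<open>\<phi> ls\<close> the product of the \<open>D^(l-1) a\<close>, this is a
  noncommutative partial Bell polynomial. The weight stays arbitrary because the recursions below
  modify it by adding or raising parts.\<close>

definition bell_sum :: "nat \<Rightarrow> nat \<Rightarrow> (nat list \<Rightarrow> 'a::ring_1) \<Rightarrow> 'a" where
  "bell_sum n m \<phi> = (\<Sum>ls\<in>compositions n m. of_nat (bell_coeff ls) * \<phi> ls)"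

text \<open>The Leibniz rule on indices: when a part \<open>l\<close> stands for
  \<open>D^(l-1) a\<close>, applying \<open>D\<close> raises one part at a time.\<close>

definition increment_sum :: "(nat list \<Rightarrow> 'a::ring_1) \<Rightarrow> nat list \<Rightarrow> 'a" where
  "increment_sum \<phi> ls = (\<Sum>i<length ls. \<phi> (ls[i := Suc (ls ! i)]))"

lemma finite_compositions: "finite (compositions n m)"
proof (rule finite_subset)
  show "compositions n m \<subseteq> {ls. set ls \<subseteq> {..m} \<and> length ls = n}"
    by (auto simp: compositions_def member_le_sum_list)
qed (simp add: finite_lists_length_eq)

lemma bell_coeff_snoc:
  "bell_coeff (ls @ [l]) = ((sum_list ls + l - 1) choose (l - 1)) * bell_coeff ls"
  by (simp add: bell_coeff_def nth_append)

lemma compositions_0: "compositions 0 m = (if m = 0 then {[]} else {})"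
  by (auto simp: compositions_def)

lemma compositions_Suc_0: "compositions (Suc n) 0 = {}"
  by (auto simp: compositions_def length_Suc_conv)

lemma bell_sum_0: "bell_sum 0 m \<phi> = (if m = 0 then \<phi> [] else 0)"
  by (simp add: bell_sum_def compositions_0 bell_coeff_def)

lemma bell_sum_Suc_0: "bell_sum (Suc n) 0 \<phi> = 0"
  by (simp add: bell_sum_def compositions_Suc_0)

lemma bij_betw_compositions_snoc:
  "bij_betw (\<lambda>(k, ls). ls @ [Suc k]) (SIGMA k:{..m}. compositions n (m - k))
    (compositions (Suc n) (Suc m))"
proof (rule bij_betwI')
  fix ls assume ls: "ls \<in> compositions (Suc n) (Suc m)"
  then obtain us l where us: "ls = us @ [l]"
    by (cases ls rule: rev_cases) (auto simp: compositions_def)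
  with ls have "l \<ge> 1" by (auto simp: compositions_def)
  then obtain k where k: "l = Suc k" by (cases l) auto
  from ls us k have "(k, us) \<in> (SIGMA k:{..m}. compositions n (m - k))"
    by (auto simp: compositions_def)
  with us k show "\<exists>x\<in>SIGMA k:{..m}. compositions n (m - k). ls = (case x of (k, ls) \<Rightarrow> ls @ [Suc k])"
    by force
qed (auto simp: compositions_def)

text \<open>Splits off the last part \<open>Suc k\<close>. The partial sum there is
  \<open>Suc m\<close>, so its factor in \<open>bell_coeff\<close> is
  \<open>m choose k\<close>.\<close>

lemma bell_sum_Suc:
  "bell_sum (Suc n) (Suc m) \<phi>
    = (\<Sum>k\<le>m. of_nat (m choose k) * bell_sum n (m - k) (\<lambda>ls. \<phi> (ls @ [Suc k])))"
proof -
  have "bell_sum (Suc n) (Suc m) \<phi>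
      = (\<Sum>(k, ls)\<in>(SIGMA k:{..m}. compositions n (m - k)).
           of_nat (bell_coeff (ls @ [Suc k])) * \<phi> (ls @ [Suc k]))"
    unfolding bell_sum_def
    by (subst sum.reindex_bij_betw[OF bij_betw_compositions_snoc, symmetric])
      (simp add: case_prod_unfold)
  also have "\<dots> = (\<Sum>k\<le>m. \<Sum>ls\<in>compositions n (m - k).
           of_nat (bell_coeff (ls @ [Suc k])) * \<phi> (ls @ [Suc k]))"
    by (subst sum.Sigma) (auto simp: finite_compositions)
  also have "\<dots> = (\<Sum>k\<le>m. of_nat (m choose k) * bell_sum n (m - k) (\<lambda>ls. \<phi> (ls @ [Suc k])))"
    unfolding bell_sum_def sum_distrib_left
    by (intro sum.cong refl) (auto simp: bell_coeff_snoc compositions_def mult.assoc)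
  finally show ?thesis .
qed

lemma bell_sum_add: "bell_sum n m (\<lambda>ls. \<phi> ls + \<psi> ls) = bell_sum n m \<phi> + bell_sum n m \<psi>"
  by (simp add: bell_sum_def distrib_left sum.distrib)

lemma increment_sum_snoc:
  "increment_sum \<phi> (ls @ [l]) = increment_sum (\<lambda>us. \<phi> (us @ [l])) ls + \<phi> (ls @ [Suc l])"
  by (simp add: increment_sum_def list_update_append nth_append)

lemma increment_sum_Cons:
  "increment_sum \<phi> (l # ls) = \<phi> (Suc l # ls) + increment_sum (\<lambda>us. \<phi> (l # us)) ls"
  by (simp add: increment_sum_def sum.lessThan_Suc_shift del: sum.lessThan_Suc)

lemma increment_sum_Nil: "increment_sum \<phi> [] = 0"
  by (simp add: increment_sum_def)

text \<open>\<open>bell_coeff\<close> splits off the last part easily, but iterated brackets are built from the left.\<close>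

lemma bell_sum_Suc_left:
  "bell_sum (Suc n) (Suc m) \<phi>
    = bell_sum n m (\<lambda>ls. \<phi> (1 # ls)) + bell_sum (Suc n) m (increment_sum \<phi>)"
proof (induction n arbitrary: m \<phi>)
  case 0
  have "bell_sum (Suc 0) (Suc m) \<phi> = \<phi> [Suc m]" for m and \<phi> :: "nat list \<Rightarrow> 'a"
    by (simp add: bell_sum_Suc bell_sum_0 if_distrib[of "(*) _"] cong: if_cong)
  then show ?case
    by (cases m) (simp_all add: bell_sum_0 bell_sum_Suc_0 increment_sum_def)
next
  case (Suc n)
  show ?case
  proof (cases m)
    case 0
    then show ?thesis by (simp add: bell_sum_Suc_0 bell_sum_Suc)
  next
    case [simp]: (Suc q)
    let ?\<phi> = "\<lambda>k ls. \<phi> (ls @ [Suc k])"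
    have "bell_sum (Suc (Suc n)) (Suc m) \<phi>
      = (\<Sum>k\<le>Suc q. of_nat (Suc q choose k) * bell_sum (Suc n) (Suc q - k) (?\<phi> k))"
      by (simp only: bell_sum_Suc Suc)
    \<comment> \<open>Pascal's rule separates the sums whose last part is raised from those of total
      \<open>Suc (q - k)\<close>, to which the induction hypothesis applies. The raised last part
      then completes \<open>increment_sum\<close>, as \<open>increment_sum_snoc\<close>
      shows.\<close>
    also have "\<dots> = (\<Sum>k\<le>q. of_nat (q choose k) *
        (bell_sum (Suc n) (q - k) (?\<phi> (Suc k)) + bell_sum (Suc n) (Suc (q - k)) (?\<phi> k)))"
      by (subst sum_binomial_Suc) (simp add: Suc_diff_le)
    also have "\<dots> = (\<Sum>k\<le>q. of_nat (q choose k) * bell_sum n (q - k) (\<lambda>ls. ?\<phi> k (1 # ls)))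
       + (\<Sum>k\<le>q. of_nat (q choose k) *
          (bell_sum (Suc n) (q - k) (increment_sum (?\<phi> k)) + bell_sum (Suc n) (q - k) (?\<phi> (Suc k))))"
      by (simp add: Suc.IH distrib_left sum.distrib add_ac)
    also have "\<dots> = bell_sum (Suc n) m (\<lambda>ls. \<phi> (1 # ls)) + bell_sum (Suc (Suc n)) m (increment_sum \<phi>)"
      by (simp add: bell_sum_Suc increment_sum_snoc bell_sum_add)
    finally show ?thesis .
  qed
qed

lemma bell_sum_cong:
  "(\<And>ls. length ls = n \<Longrightarrow> (\<And>l. l \<in> set ls \<Longrightarrow> l \<ge> 1) \<Longrightarrow> \<phi> ls = \<psi> ls)
    \<Longrightarrow> bell_sum n m \<phi> = bell_sum n m \<psi>"
  unfolding bell_sum_def by (intro sum.cong refl) (auto simp: compositions_def)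

lemma (in ring_derivation) bell_sum: "d (bell_sum n m \<phi>) = bell_sum n m (\<lambda>ls. d (\<phi> ls))"
  by (simp add: bell_sum_def sum mult of_nat)

text \<open>With partial sums \<open>s_i\<close>, each factor is
  \<open>(s_i - 1)! / ((l_i - 1)! s_(i-1)!)\<close>, and
  \<open>s_(i-1)! = s_(i-1) (s_(i-1) - 1)!\<close> makes the product telescope. The identity is kept
  free of division so that it can be mapped into characteristic \<open>p\<close>.\<close>

lemma bell_coeff_fact:
  assumes "ls \<noteq> []" "\<forall>l\<in>set ls. l \<ge> 1"
  shows "bell_coeff ls * (\<Prod>v = 1..length ls - 1. sum_list (take v ls))
      * prod_list (map (\<lambda>l. fact (l - 1)) ls) = (fact (sum_list ls - 1) :: nat)"
  using assms
proof (induction ls rule: rev_induct)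
  case (snoc l ls)
  show ?case
  proof (cases "ls = []")
    case True
    then show ?thesis by (simp add: bell_coeff_def)
  next
    case False
    define s where "s = sum_list ls"
    have "s \<ge> 1"
      using False snoc.prems by (cases ls) (auto simp: s_def)
    have l: "l \<ge> 1" using snoc.prems by simp
    have IH: "bell_coeff ls * (\<Prod>v = 1..length ls - 1. sum_list (take v ls))
      * prod_list (map (\<lambda>l. fact (l - 1)) ls) = (fact (s - 1) :: nat)"
      using snoc False by (simp add: s_def)
    \<comment> \<open>Appending \<open>l\<close> turns all of \<open>ls\<close> into a proper
      prefix, so the product of partial sums gains the factor \<open>s\<close>.\<close>
    have "{1..length ls} = insert (length ls) {1..length ls - 1}"
      using False by (cases ls) auto
    then have "(\<Prod>v = 1..length ls. sum_list (take v (ls @ [l])))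
      = s * (\<Prod>v = 1..length ls - 1. sum_list (take v (ls @ [l])))"
      using False by (cases ls) (auto simp: s_def)
    also have "(\<Prod>v = 1..length ls - 1. sum_list (take v (ls @ [l])))
        = (\<Prod>v = 1..length ls - 1. sum_list (take v ls))"
      by (intro prod.cong refl) auto
    finally have C: "(\<Prod>v = 1..length ls. sum_list (take v (ls @ [l])))
        = s * (\<Prod>v = 1..length ls - 1. sum_list (take v ls))" .
    have "s * fact (s - 1) = (fact s :: nat)"
      using \<open>s \<ge> 1\<close> by (simp add: fact_reduce)
    moreover have "((s + l - 1) choose (l - 1)) * fact (l - 1) * fact s = (fact (s + l - 1) :: nat)"
      using binomial_fact_lemma[of "l - 1" "s + l - 1"] l by (simp add: mult_ac)
    ultimately have "((s + l - 1) choose (l - 1)) * s * fact (l - 1)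
      * (bell_coeff ls * (\<Prod>v = 1..length ls - 1. sum_list (take v ls))
      * prod_list (map (\<lambda>l. fact (l - 1)) ls)) = (fact (s + l - 1) :: nat)"
      unfolding IH by (metis mult.assoc mult.commute)
    then show ?thesis
      by (simp only: bell_coeff_snoc C length_append_singleton diff_Suc_1 map_append prod_list.append
          list.map prod_list.Cons prod_list.Nil s_def sum_list_append sum_list.Cons sum_list.Nil add_0_right
          mult_1_right mult_1_left add_0_left ac_simps)
  qed
qed simp

section \<open>Iterated commutators of the derivatives of \<open>a\<close>\<close>

definition comm_br :: "'a::ring_1 \<Rightarrow> 'a \<Rightarrow> 'a" where
  "comm_br s t = s * t - t * s"

abbreviation iter_comm :: "('a::ring_1 \<Rightarrow> 'a) \<Rightarrow> 'a \<Rightarrow> nat list \<Rightarrow> 'a" where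
  "iter_comm D a ls \<equiv> iter_br comm_br (map (\<lambda>l. (D ^^ (l - 1)) a) ls)"

lemma iter_br_Cons: "xs \<noteq> [] \<Longrightarrow> iter_br b (x # xs) = b x (iter_br b xs)"
  by (cases xs) auto

lemma (in ring_derivation) iter_comm:
  assumes "\<And>l. l \<in> set ls \<Longrightarrow> l \<ge> 1"
  shows "d (iter_comm d a ls) = increment_sum (iter_comm d a) ls"
  using assms
proof (induction ls)
  case Nil
  then show ?case by (simp add: increment_sum_Nil zero)
next
  case (Cons l ls)
  \<comment> \<open>Here \<open>l \<ge> 1\<close> matters: at \<open>l = 0\<close> truncated
    subtraction would leave \<open>a\<close> on the left and \<open>d a\<close> on the
    right.\<close>
  have l: "(d ^^ l) a = d ((d ^^ (l - 1)) a)"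
    using Cons.prems[of l] by (cases l) auto
  show ?case
  proof (cases "ls = []")
    case True
    then show ?thesis by (simp add: increment_sum_def l)
  next
    case False
    have br: "increment_sum (\<lambda>us. iter_comm d a (l # us)) ls
        = comm_br ((d ^^ (l - 1)) a) (increment_sum (iter_comm d a) ls)"
      unfolding increment_sum_def comm_br_def sum_distrib_left sum_distrib_right sum_subtractf[symmetric]
      using False by (intro sum.cong refl) (simp add: iter_br_Cons comm_br_def)
    have "d (comm_br s t) = comm_br (d s) t + comm_br s (d t)" for s t
      by (simp add: comm_br_def diff mult)
    then show ?thesis
      unfolding increment_sum_Cons br using False Cons by (simp add: iter_br_Cons l)
  qed
qed

section \<open>Homogeneous components in the central variable\<close>

abbreviation (input) fps_map :: "('a::ring_1 \<Rightarrow> 'a) \<Rightarrow> 'a fps \<Rightarrow> 'a fps" where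
  "fps_map D f \<equiv> Abs_fps (\<lambda>n. D (fps_nth f n))"

text \<open>Multiplication by \<open>a X\<close> raises the degree by one and \<open>D\<close>
  preserves it. Hence degree \<open>m\<close> never uses \<open>D\<close>, and degree
  \<open>1\<close> uses \<open>a\<close> once, necessarily first because
  \<open>D 1 = 0\<close>.\<close>

lemma nth_deriv_pow_fps:
  "fps_nth (deriv_pow (fps_map D) (fps_X * fps_const a) (Suc m)) n
    = (if n = 0 then 0 else a * fps_nth (deriv_pow (fps_map D) (fps_X * fps_const a) m) (n - 1))
      + D (fps_nth (deriv_pow (fps_map D) (fps_X * fps_const a) m) n)"
  by (simp add: deriv_pow_Suc mult.assoc fps_X_mult_nth)

context ring_derivation begin

lemma nth_deriv_pow_fps_eq_0:
  "n > m \<Longrightarrow> fps_nth (deriv_pow (fps_map d) (fps_X * fps_const a) m) n = 0"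
  by (induction m arbitrary: n) (simp_all add: nth_deriv_pow_fps zero deriv_pow_0)

lemma nth_deriv_pow_fps_top:
  "fps_nth (deriv_pow (fps_map d) (fps_X * fps_const a) m) m = a ^ m"
  by (induction m) (simp_all add: nth_deriv_pow_fps zero deriv_pow_0 nth_deriv_pow_fps_eq_0)

lemma nth_deriv_pow_fps_0:
  "fps_nth (deriv_pow (fps_map d) (fps_X * fps_const a) m) 0 = (if m = 0 then 1 else 0)"
  by (induction m) (simp_all add: nth_deriv_pow_fps zero one deriv_pow_0)

lemma nth_deriv_pow_fps_1:
  "fps_nth (deriv_pow (fps_map d) (fps_X * fps_const a) (Suc m)) 1 = (d ^^ m) a"
  by (induction m) (simp_all add: nth_deriv_pow_fps nth_deriv_pow_fps_0 deriv_pow_0 zero)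

text \<open>Evaluation at \<open>X = 1\<close>; the sum stops at \<open>m\<close> because higher
  coefficients vanish.\<close>

lemma sum_nth_deriv_pow_fps:
  "(\<Sum>n\<le>m. fps_nth (deriv_pow (fps_map d) (fps_X * fps_const a) m) n) = deriv_pow d a m"
proof (induction m)
  case 0
  then show ?case by (simp add: deriv_pow_0)
next
  case (Suc m)
  let ?y = "\<lambda>m n. fps_nth (deriv_pow (fps_map d) (fps_X * fps_const a) m) n"
  have "(\<Sum>n\<le>Suc m. ?y (Suc m) n) = (\<Sum>n\<le>Suc m. if n = 0 then 0 else a * ?y m (n - 1)) + (\<Sum>n\<le>Suc m. d (?y m n))"
    by (simp only: nth_deriv_pow_fps sum.distrib)
  also have "(\<Sum>n\<le>Suc m. if n = 0 then 0 else a * ?y m (n - 1)) = a * (\<Sum>n\<le>m. ?y m n)"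
    by (simp add: sum.atMost_Suc_shift sum_distrib_left del: sum.atMost_Suc)
  also have "(\<Sum>n\<le>Suc m. d (?y m n)) = d (\<Sum>n\<le>m. ?y m n)"
    by (simp add: nth_deriv_pow_fps_eq_0 sum zero)
  finally show ?case by (simp add: Suc.IH deriv_pow_Suc)
qed

text \<open>Both sides obey the same recursion: bracketing with \<open>a X\<close> prepends a part
  \<open>1\<close>, and \<open>D\<close> raises one part. On the right this is
  \<open>bell_sum_Suc_left\<close>.\<close>

lemma nth_lie_pow_fps:
  "fps_nth (lie_pow (fps_map d) (fps_X * fps_const a) (fps_X * fps_const a) m) n
    = bell_sum n m (iter_comm d a)"
proof (induction m arbitrary: n)
  case 0
  then show ?case by (cases n) (simp_all add: bell_sum_0 bell_sum_Suc_0)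
next
  case (Suc m)
  let ?z = "\<lambda>m n. fps_nth (lie_pow (fps_map d) (fps_X * fps_const a) (fps_X * fps_const a) m) n"
  \<comment> \<open>Since \<open>fps_X\<close> is central, right multiplication by
    \<open>a X\<close> also shifts the degree by one.\<close>
  have X: "f * (fps_X * fps_const a) = fps_X * (f * fps_const a)" for f
    by (metis fps_mult_fps_X_commute mult.assoc)
  have rec: "?z (Suc m) n = (if n = 0 then 0 else comm_br a (?z m (n - 1))) + d (?z m n)
     + (if m = 0 \<and> n = 1 then a else 0)"
    by (auto simp: X comm_br_def mult.assoc fps_X_mult_nth)
  show ?case
  proof (cases n)
    case 0
    then show ?thesis using Suc.IH[of 0] by (simp only: rec) (simp add: bell_sum_0 zero)
  next
    case [simp]: (Suc j)
    have "bell_sum n (Suc m) (iter_comm d a)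
      = bell_sum j m (\<lambda>ls. iter_comm d a (1 # ls)) + bell_sum n m (increment_sum (iter_comm d a))"
      by (simp only: Suc bell_sum_Suc_left)
    also have "bell_sum n m (increment_sum (iter_comm d a)) = d (bell_sum n m (iter_comm d a))"
      unfolding bell_sum by (rule bell_sum_cong, rule iter_comm[symmetric]) auto
    \<comment> \<open>On the empty list \<open>iter_br\<close> has the default value
      \<open>0\<close>, whereas the list \<open>[1]\<close> must give \<open>a\<close>. The
      correction term matches the value that \<open>lie_pow\<close> adds at its first step.\<close>
    also have "bell_sum j m (\<lambda>ls. iter_comm d a (1 # ls))
       = bell_sum j m (\<lambda>ls. comm_br a (iter_comm d a ls) + (if ls = [] then a else 0))"
      by (intro bell_sum_cong) (auto simp: iter_br_Cons comm_br_def)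
    also have "\<dots> = comm_br a (bell_sum j m (iter_comm d a)) + (if m = 0 \<and> j = 0 then a else 0)"
    proof -
      have "bell_sum j m (\<lambda>ls. if ls = [] then a else 0) = (if m = 0 \<and> j = 0 then a else 0)"
      proof -
        have "bell_sum n m (\<lambda>_. 0 :: 'a) = 0" for n m
          by (simp add: bell_sum_def)
        then show ?thesis
          by (cases j; cases m) (auto simp: bell_sum_0 bell_sum_Suc_0 bell_sum_Suc)
      qed
      moreover have "bell_sum j m (\<lambda>ls. comm_br a (iter_comm d a ls)) = comm_br a (bell_sum j m (iter_comm d a))"
        by (simp add: bell_sum_def comm_br_def sum_distrib_left sum_distrib_right right_diff_distrib
            sum_subtractf mult_of_nat_left_commute mult.assoc)
      ultimately show ?thesis by (simp add: bell_sum_add)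
    qed
    finally show ?thesis by (simp only: rec Suc.IH) (simp add: add_ac)
  qed
qed

text \<open>The component \<open>y n\<close> is described through \<open>n\<close> times itself,
  since division by \<open>n\<close> need not make sense in the ring; it is carried out later over
  the field.\<close>

theorem deriv_pow_char:
  assumes p: "prime p" "of_nat p = (0::'a)"
  shows "\<exists>y. (\<forall>n. of_nat n * y n = bell_sum n p (iter_comm d a)) \<and>
    deriv_pow d a p = a ^ p + (d ^^ (p - 1)) a + (\<Sum>n=2..<p. y n)"
proof -
  let ?a = "fps_X * fps_const a"
  let ?E = "\<lambda>f. Abs_fps (\<lambda>n. of_nat n * fps_nth f n) :: 'a fps"
  define y where "y n = fps_nth (deriv_pow (fps_map d) ?a p) n" for n
  have "lie_pow (fps_map d) ?a (?E ?a) p = ?E (deriv_pow (fps_map d) ?a p)"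
    using p by (intro lie_pow_char ring_derivation_fps ring_derivation_fps_degree)
      (unfold_locales, auto simp: fps_eq_iff mult of_nat fps_of_nat[symmetric] fps_const_0_eq_0)
  \<comment> \<open>The element \<open>a X\<close> is homogeneous of degree \<open>1\<close>, so
    \<open>Z\<close> starts with \<open>a X\<close> itself.\<close>
  moreover have "?E ?a = ?a"
    by (auto simp: fps_eq_iff fps_X_mult_nth)
  ultimately have "fps_nth (lie_pow (fps_map d) ?a ?a p) n = of_nat n * y n" for n
    by (simp add: y_def)
  then have "of_nat n * y n = bell_sum n p (iter_comm d a)" for n
    by (simp add: nth_lie_pow_fps)
  moreover have "deriv_pow d a p = a ^ p + (d ^^ (p - 1)) a + (\<Sum>n=2..<p. y n)"
  proof -
    have "p \<ge> 2" using p(1) by (rule prime_ge_2_nat)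
    \<comment> \<open>Degree \<open>0\<close> contributes nothing, and \<open>p \<ge> 2\<close>
      keeps the degrees \<open>1\<close> and \<open>p\<close> apart.\<close>
    then have "{..p} = insert 0 (insert 1 (insert p {2..<p}))" by auto
    then have "deriv_pow d a p = y 0 + y 1 + y p + (\<Sum>n=2..<p. y n)"
      using \<open>p \<ge> 2\<close> by (simp add: y_def add_ac flip: sum_nth_deriv_pow_fps)
    moreover have "y 1 = (d ^^ (p - 1)) a"
      using nth_deriv_pow_fps_1[of a "p - 1"] \<open>p \<ge> 2\<close> by (simp add: y_def)
    ultimately show ?thesis
      using \<open>p \<ge> 2\<close> by (simp add: y_def nth_deriv_pow_fps_0 nth_deriv_pow_fps_top add_ac)
  qed
  ultimately show ?thesis by blast
qed

end


section \<open>Coproducts of primitive elements\<close>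

lemma poly_mapping_add_induct:
  fixes t :: "'a \<Rightarrow>\<^sub>0 'k::field"
  assumes "\<And>w c. P (Poly_Mapping.single w c)" "\<And>s t. P s \<Longrightarrow> P t \<Longrightarrow> P (s + t)"
  shows "P t"
proof -
  have "P 0"
    using assms(1)[of undefined 0] by simp
  then have "P (\<Sum>w\<in>A. Poly_Mapping.single w (Poly_Mapping.lookup t w))" for A
    using assms by (induction A rule: infinite_finite_induct) simp_all
  then show ?thesis
    by (metis poly_mapping_sum_monomials)
qed

lemma lin_ext_lin_ext:
  "lin_ext f (lin_ext (\<lambda>w. Poly_Mapping.single (h w) 1) t) = lin_ext (\<lambda>w. f (h w)) t"
  by (induction t rule: poly_mapping_add_induct) (simp_all add: lin_ext_single mult_single lin_ext_add)

lemma lin_ext_single_mult: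
  "lin_ext f (Poly_Mapping.single u c * t) = Poly_Mapping.single 0 c * lin_ext (\<lambda>w. f (u + w)) t"
  by (induction t rule: poly_mapping_add_induct)
    (simp_all add: lin_ext_single mult_single lin_ext_add distrib_left flip: mult.assoc)

lemma lin_ext_mult_single:
  "lin_ext f (t * Poly_Mapping.single u c) = Poly_Mapping.single 0 c * lin_ext (\<lambda>w. f (w + u)) t"
  by (induction t rule: poly_mapping_add_induct)
    (simp_all add: lin_ext_single mult_single lin_ext_add distrib_left distrib_right
      mult.commute[of c] flip: mult.assoc)

lemma ideal_typeI:
  fixes J :: "'a::ring_1 set"
  assumes "0 \<in> J" "\<And>a b. a \<in> J \<Longrightarrow> b \<in> J \<Longrightarrow> a + b \<in> J"
    and "\<And>a x. a \<in> J \<Longrightarrow> x * a \<in> J" "\<And>a x. a \<in> J \<Longrightarrow> a * x \<in> J"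
  shows "ideal J ring_of_type_algebra"
proof (rule idealI[OF ring_type])
  interpret R: ring "ring_of_type_algebra :: 'a ring" by (rule ring_type)
  have "\<ominus>\<^bsub>ring_of_type_algebra\<^esub> a = - a" for a :: 'a
    by (rule R.minus_equality) (simp_all add: type_simps)
  moreover have "- a \<in> J" if "a \<in> J" for a
    using assms(3)[OF that, of "- 1"] by simp
  ultimately show "subgroup J (add_monoid ring_of_type_algebra)"
    using assms(1,2) by (intro R.add.subgroupI) (auto simp: type_simps)
qed (use assms in \<open>auto simp: type_simps\<close>)

section \<open>Arithmetic of classes in the enveloping algebra\<close>

lemma
  shows uclass_add: "uclass scale br (s + t) = uclass scale br s \<oplus>\<^bsub>uenv scale br\<^esub> uclass scale br t"
    and uclass_mult: "uclass scale br (s * t) = uclass scale br s \<otimes>\<^bsub>uenv scale br\<^esub> uclass scale br t"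
    and uclass_one: "uclass scale br 1 = \<one>\<^bsub>uenv scale br\<^esub>"
  using ring_hom_add[OF uclass_hom, of s t scale br] ring_hom_mult[OF uclass_hom, of s t scale br]
    ring_hom_one[OF uclass_hom, of scale br]
  by (simp_all add: type_simps)

lemma uclass_closed: "uclass scale br t \<in> carrier (uenv scale br)"
  by (simp add: carrier_uenv)

lemma uclass_zero: "uclass scale br 0 = \<zero>\<^bsub>uenv scale br\<^esub>"
  by (rule ring_hom_zero[OF uclass_hom ring_type ring_uenv, of scale br, unfolded type_simps])

lemma uclass_diff: "uclass scale br (s - t) = uclass scale br s \<ominus>\<^bsub>uenv scale br\<^esub> uclass scale br t"
proof -
  interpret ring "uenv scale br" by (rule ring_uenv)
  have "uclass scale br s = uclass scale br (s - t) \<oplus>\<^bsub>uenv scale br\<^esub> uclass scale br t"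
    by (simp flip: uclass_add)
  then show ?thesis
    by (simp add: uclass_closed a_minus_def a_assoc r_neg)
qed

lemma uclass_power: "uclass scale br (t ^ n) = uclass scale br t [^]\<^bsub>uenv scale br\<^esub> n"
proof -
  interpret ring "uenv scale br" by (rule ring_uenv)
  show ?thesis
    by (induction n) (simp_all add: uclass_one power_Suc2 uclass_mult del: power_Suc)
qed

lemma uclass_eq_iff: "uclass scale br s = uclass scale br t \<longleftrightarrow> s - t \<in> env_ideal scale br"
proof
  assume "uclass scale br s = uclass scale br t"
  moreover have "s \<in> uclass scale br s"
    by (simp add: in_uclass_iff ideal_type_closed(4)[OF ideal_env])
  ultimately show "s - t \<in> env_ideal scale br" by (simp add: in_uclass_iff)
next
  assume *: "s - t \<in> env_ideal scale br"
  have "r - s \<in> env_ideal scale br \<longleftrightarrow> r - t \<in> env_ideal scale br" for r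
    using ideal_type_closed(1)[OF ideal_env _ *, of "r - s"]
      ideal_type_closed(6)[OF ideal_env _ *, of "r - t"] by auto
  then show "uclass scale br s = uclass scale br t" by (auto simp: in_uclass_iff)
qed

lemma uclass_eq_zero_iff: "uclass scale br t = \<zero>\<^bsub>uenv scale br\<^esub> \<longleftrightarrow> t \<in> env_ideal scale br"
  using uclass_eq_iff[of scale br t 0] by (simp add: uclass_zero)

lemma uscale_uclass: "uscale scale br c (uclass scale br t) = uclass scale br (Poly_Mapping.single 0 c * t)"
  by (simp add: uscale_def uclass_mult)

lemma uclass_sum:
  assumes "finite A"
  shows "uclass scale br (sum f A) = (\<Oplus>\<^bsub>uenv scale br\<^esub>a\<in>A. uclass scale br (f a))"
proof -
  interpret ring "uenv scale br" by (rule ring_uenv)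
  show ?thesis
    using assms by (induction A rule: finite_induct) (simp_all add: uclass_zero uclass_add uclass_closed)
qed

lemma uincl_closed: "uincl scale br x \<in> carrier (uenv scale br)"
  by (simp add: uincl_def uclass_closed)

lemma uincl_add: "uincl scale br (x + y) = uincl scale br x \<oplus>\<^bsub>uenv scale br\<^esub> uincl scale br y"
proof -
  have "gen (x + y) - (gen x + gen y) \<in> env_ideal scale br"
    using env_rels_ideal by (force simp: env_rels_def diff_diff_eq)
  then show ?thesis
    by (simp add: uincl_def uclass_eq_iff flip: uclass_add)
qed

lemma uincl_scale: "uincl scale br (scale c x) = uscale scale br c (uincl scale br x)"
proof -
  have "gen (scale c x) - Poly_Mapping.single 0 c * gen x \<in> env_ideal scale br"
    using env_rels_ideal by (force simp: env_rels_def)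
  then show ?thesis
    by (simp add: uincl_def uclass_eq_iff uscale_uclass)
qed

lemma uincl_br:
  "uincl scale br (br x y) = uincl scale br x \<otimes>\<^bsub>uenv scale br\<^esub> uincl scale br y
     \<ominus>\<^bsub>uenv scale br\<^esub> uincl scale br y \<otimes>\<^bsub>uenv scale br\<^esub> uincl scale br x"
proof -
  have "gen x * gen y - gen y * gen x - gen (br x y) \<in> env_ideal scale br"
    using env_rels_ideal by (force simp: env_rels_def)
  then show ?thesis
    unfolding uincl_def by (metis uclass_eq_iff uclass_diff uclass_mult)
qed

lemma uincl_zero: "uincl scale br 0 = \<zero>\<^bsub>uenv scale br\<^esub>"
proof -
  interpret ring "uenv scale br" by (rule ring_uenv)
  show ?thesis
    using uincl_add[of scale br 0 0] uincl_closed[of scale br 0] by (simp add: add.r_cancel_one')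
qed

lemma uincl_sum:
  assumes "finite A"
  shows "uincl scale br (sum f A) = (\<Oplus>\<^bsub>uenv scale br\<^esub>a\<in>A. uincl scale br (f a))"
proof -
  interpret ring "uenv scale br" by (rule ring_uenv)
  show ?thesis
    using assms by (induction A rule: finite_induct) (simp_all add: uincl_zero uincl_add uincl_closed)
qed

section \<open>Sweedler sums over a primitive element\<close>

text \<open>This gives independence of the representative of a coproduct: a map on pairs of words
  that respects the relations in each tensor factor respects them on the tensor square.\<close>

lemma lin_ext_env_ideal2:
  fixes scale :: "'k::field \<Rightarrow> 'g::ab_group_add \<Rightarrow> 'g"
    and br :: "'g \<Rightarrow> 'g \<Rightarrow> 'g"
    and f :: "'g word \<times> 'g word \<Rightarrow> ('g word \<Rightarrow>\<^sub>0 'k)"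
  defines "I \<equiv> env_ideal scale br"
  assumes "\<And>t v. t \<in> I \<Longrightarrow> lin_ext (\<lambda>u. f (u, v)) t \<in> I"
    and "\<And>t u. t \<in> I \<Longrightarrow> lin_ext (\<lambda>v. f (u, v)) t \<in> I"
    and "s \<in> env_ideal2 scale br"
  shows "lin_ext f s \<in> I"
proof -
  txt \<open>The kernel of a single \<open>lin_ext f\<close> modulo \<open>I\<close> need not be an ideal; quantifying over all
    admissible \<open>f\<close> makes it one, since shifts of admissible functions are admissible.\<close>
  define P :: "('g word \<times> 'g word \<Rightarrow> ('g word \<Rightarrow>\<^sub>0 'k)) \<Rightarrow> bool" where "P f \<longleftrightarrow>
    (\<forall>t\<in>I. \<forall>v. lin_ext (\<lambda>u. f (u, v)) t \<in> I \<and> lin_ext (\<lambda>u. f (v, u)) t \<in> I)" for f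
  define J where "J = {s. \<forall>f. P f \<longrightarrow> lin_ext f s \<in> I}"
  note closed = ideal_type_closed[OF ideal_env[of scale br], folded I_def]
  have P_shift: "P (\<lambda>w. f (z + w))" "P (\<lambda>w. f (w + z))" if "P f" for f z
  proof -
    obtain a b where z: "z = (a, b)" by (cases z)
    have "lin_ext (\<lambda>u. f (z + (u, v))) t \<in> I \<and> lin_ext (\<lambda>u. f (z + (v, u))) t \<in> I
        \<and> lin_ext (\<lambda>u. f ((u, v) + z)) t \<in> I \<and> lin_ext (\<lambda>u. f ((v, u) + z)) t \<in> I"
      if "t \<in> I" for t v
    proof -
      have 1: "Poly_Mapping.single w 1 * t \<in> I" "t * Poly_Mapping.single w 1 \<in> I" for w
        using that closed by blast+
      have "lin_ext (\<lambda>u. f (u, v')) (Poly_Mapping.single w 1 * t) \<in> I"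
        "lin_ext (\<lambda>u. f (u, v')) (t * Poly_Mapping.single w 1) \<in> I"
        "lin_ext (\<lambda>u. f (v', u)) (Poly_Mapping.single w 1 * t) \<in> I"
        "lin_ext (\<lambda>u. f (v', u)) (t * Poly_Mapping.single w 1) \<in> I" for w v'
        using 1 \<open>P f\<close> by (auto simp: P_def)
      then show ?thesis
        by (simp add: lin_ext_single_mult lin_ext_mult_single z)
    qed
    then show "P (\<lambda>w. f (z + w))" "P (\<lambda>w. f (w + z))" by (auto simp: P_def)
  qed
  have "ideal J ring_of_type_algebra"
  proof (rule ideal_typeI)
    fix a x assume a: "a \<in> J"
    have "lin_ext f (x * a) \<in> I \<and> lin_ext f (a * x) \<in> I" if f: "P f" for f
    \<comment> \<open>It suffices to multiply by monomials, which amounts to a scalar and a shift of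
      \<open>f\<close>.\<close>
    proof (induction x rule: poly_mapping_add_induct)
      case (1 w c)
      show ?case
        unfolding lin_ext_single_mult lin_ext_mult_single
        using a P_shift[OF f] closed by (simp add: J_def)
    next
      case (2 s t)
      then show ?case by (simp add: distrib_left distrib_right lin_ext_add closed)
    qed
    then show "x * a \<in> J" "a * x \<in> J" by (auto simp: J_def)
  qed (auto simp: J_def lin_ext_add closed)
  moreover have "tens t 1 \<in> J" "tens 1 t \<in> J" if "t \<in> I" for t
    using that by (auto simp: J_def P_def tens_1_right tens_1_left lin_ext_lin_ext)
  ultimately have "env_ideal2 scale br \<subseteq> J"
    unfolding env_ideal2_def by (intro ring.genideal_minimal[OF ring_type]) (auto simp: I_def)
  moreover have "P f" using assms by (auto simp: P_def)
  ultimately show ?thesis using assms by (auto simp: J_def)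
qed

lemma sweedler_uincl:
  fixes scale :: "'k::field \<Rightarrow> 'g::ab_group_add \<Rightarrow> 'g"
  assumes B: "u_bilinear scale br B"
  shows "sweedler scale br B (uincl scale br x)
    = B (uincl scale br x) \<one>\<^bsub>uenv scale br\<^esub> \<oplus>\<^bsub>uenv scale br\<^esub> B \<one>\<^bsub>uenv scale br\<^esub> (uincl scale br x)"
proof -
  let ?cl = "uclass scale br" and ?m = "\<lambda>w. Poly_Mapping.single w (1::'k)"
  interpret ring "uenv scale br" by (rule ring_uenv)
  note B' = B[unfolded u_bilinear_def Let_def]
  \<comment> \<open>Representatives of the values of \<open>B\<close> on words are chosen in the
    free algebra, so that the Sweedler sum becomes the class of \<open>lin_ext f s\<close>.\<close>
  have "\<exists>t. ?cl t = B (?cl (?m (fst w))) (?cl (?m (snd w)))" for w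
    using B' uclass_closed[of scale br] unfolding carrier_uenv by (metis imageE)
  then obtain f where "\<And>w. ?cl (f w) = B (?cl (?m (fst w))) (?cl (?m (snd w)))"
    by metis
  then have f: "?cl (f (u, v)) = B (?cl (?m u)) (?cl (?m v))" for u v by simp
  have fst_f: "?cl (lin_ext (\<lambda>u. f (u, v)) t) = B (?cl t) (?cl (?m v))" for t v
  proof (induction t rule: poly_mapping_add_induct)
    case (1 w c)
    have "?cl (lin_ext (\<lambda>u. f (u, v)) (Poly_Mapping.single w c)) = B (uscale scale br c (?cl (?m w))) (?cl (?m v))"
      using B' by (simp add: lin_ext_single f uclass_closed flip: uscale_uclass)
    then show ?case by (simp add: uscale_uclass mult_single)
  next
    case (2 s t)
    then show ?case using B' by (simp add: lin_ext_add uclass_add uclass_closed)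
  qed
  have snd_f: "?cl (lin_ext (\<lambda>v. f (u, v)) t) = B (?cl (?m u)) (?cl t)" for t u
  proof (induction t rule: poly_mapping_add_induct)
    case (1 w c)
    have "?cl (lin_ext (\<lambda>v. f (u, v)) (Poly_Mapping.single w c)) = B (?cl (?m u)) (uscale scale br c (?cl (?m w)))"
      using B' by (simp add: lin_ext_single f uclass_closed flip: uscale_uclass)
    then show ?case by (simp add: uscale_uclass mult_single)
  next
    case (2 s t)
    then show ?case using B' by (simp add: lin_ext_add uclass_add uclass_closed)
  qed
  have zero: "uscale scale br 0 E = \<zero>\<^bsub>uenv scale br\<^esub>" if "E \<in> carrier (uenv scale br)" for E
    using that by (simp add: uscale_def uclass_zero)
  have B0: "B \<zero>\<^bsub>uenv scale br\<^esub> E = \<zero>\<^bsub>uenv scale br\<^esub>" "B E \<zero>\<^bsub>uenv scale br\<^esub> = \<zero>\<^bsub>uenv scale br\<^esub>"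
    if "E \<in> carrier (uenv scale br)" for E
    using B' that by (metis zero zero_closed)+
  define s where "s = (SOME s. s \<in> coprod scale br (uincl scale br x))"
  \<comment> \<open>The representative \<open>s\<close> picked by \<open>SOME\<close> is unknown; it
    is compared with the explicit representative of
    \<open>x \<otimes> 1 + 1 \<otimes> x\<close>.\<close>
  define r where "r = tens (gen x) 1 + tens 1 (gen x :: 'g word \<Rightarrow>\<^sub>0 'k)"
  have mem: "t \<in> coprod scale br (uincl scale br x) \<longleftrightarrow> t - r \<in> env_ideal2 scale br" for t
    by (simp add: coprod_uincl r_def uclass2_def in_a_r_coset_type)
  have "r \<in> coprod scale br (uincl scale br x)"
    using ideal_type_closed(4)[OF ideal_env2] by (simp add: mem)
  then have "s \<in> coprod scale br (uincl scale br x)"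
    unfolding s_def by (rule someI)
  then have "lin_ext f (s - r) \<in> env_ideal scale br"
    using fst_f snd_f by (intro lin_ext_env_ideal2)
      (auto simp: mem B0 uclass_closed simp flip: uclass_eq_zero_iff)
  then have "?cl (lin_ext f s) = ?cl (lin_ext f r)"
    by (simp add: uclass_eq_iff lin_ext_diff)
  moreover have "sweedler scale br B (uincl scale br x) = ?cl (lin_ext f s)"
    unfolding sweedler_def Let_def s_def[symmetric] lin_ext_def
    by (subst uclass_sum) (auto simp: case_prod_unfold f[of "fst w" "snd w" for w, simplified] uscale_uclass[symmetric]
        intro!: finsum_cong')
  moreover have "?cl (lin_ext f r) = B (uincl scale br x) \<one>\<^bsub>uenv scale br\<^esub>
      \<oplus>\<^bsub>uenv scale br\<^esub> B \<one>\<^bsub>uenv scale br\<^esub> (uincl scale br x)"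
    using f by (simp add: r_def lin_ext_add tens_1_right tens_1_left lin_ext_lin_ext uclass_add
        gen_def lin_ext_single uincl_def single_one uclass_one)
  ultimately show ?thesis by simp
qed


section \<open>The star product with a primitive element\<close>

fun list_deriv :: "('g \<Rightarrow> 'g) \<Rightarrow> 'g list \<Rightarrow> ('g word \<Rightarrow>\<^sub>0 'k::field)" where
  "list_deriv h [] = 0"
| "list_deriv h (x # xs) = gen (h x) * Poly_Mapping.single (Word xs) 1 + gen x * list_deriv h xs"

text \<open>The elements of the Lie algebra are independent letters here, so a function
  \<open>h\<close> on letters extends to a derivation by the Leibniz rule.\<close>

definition free_deriv :: "('g \<Rightarrow> 'g) \<Rightarrow> ('g word \<Rightarrow>\<^sub>0 'k::field) \<Rightarrow> ('g word \<Rightarrow>\<^sub>0 'k)" where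
  "free_deriv h = lin_ext (\<lambda>w. list_deriv h (letters w))"

lemma single_Word_append:
  "Poly_Mapping.single (Word (xs @ ys)) (1::'k::field) = Poly_Mapping.single (Word xs) 1 * Poly_Mapping.single (Word ys) 1"
  by (simp add: mult_single plus_word_def)

lemma single_Word_Cons:
  "Poly_Mapping.single (Word (x # xs)) (1::'k::field) = gen x * Poly_Mapping.single (Word xs) 1"
  by (simp add: mult_single plus_word_def gen_def)

lemma single_Word_Nil: "Poly_Mapping.single (Word []) (1::'k::field) = 1"
  by (simp flip: zero_word_def)

lemma list_deriv_append:
  "list_deriv h (xs @ ys) = list_deriv h xs * Poly_Mapping.single (Word ys) 1
     + Poly_Mapping.single (Word xs) 1 * list_deriv h ys"
  by (induction xs) (simp_all add: single_Word_append single_Word_Cons single_Word_Nil algebra_simps)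

lemma ring_derivation_free_deriv: "ring_derivation (free_deriv h)"
proof
  fix s t :: "'a word \<Rightarrow>\<^sub>0 'b::field"
  show "free_deriv h (s + t) = free_deriv h s + free_deriv h t" for s t :: "'a word \<Rightarrow>\<^sub>0 'b"
    by (simp add: free_deriv_def lin_ext_add)
  note add = this
  show "free_deriv h (s * t) = free_deriv h s * t + s * free_deriv h t"
  proof (induction s rule: poly_mapping_add_induct)
    case (1 u c)
    show ?case
    proof (induction t rule: poly_mapping_add_induct)
      case (1 v c')
      have c: "Poly_Mapping.single w e = Poly_Mapping.single 0 e * Poly_Mapping.single (Word (letters w)) 1"
        for w :: "'a word" and e :: 'b
        by (simp add: mult_single)
      have "free_deriv h (Poly_Mapping.single u c * Poly_Mapping.single v c')
          = Poly_Mapping.single 0 c * Poly_Mapping.single 0 c' *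
            (list_deriv h (letters u) * Poly_Mapping.single (Word (letters v)) 1
             + Poly_Mapping.single (Word (letters u)) 1 * list_deriv h (letters v))"
        by (simp add: free_deriv_def mult_single[of u] mult_single[of 0 c 0 c'] lin_ext_single
            list_deriv_append) (simp add: plus_word_def list_deriv_append)
      \<comment> \<open>The central scalar \<open>c'\<close> is moved past the word of
        \<open>u\<close> and its derivative.\<close>
      also have "\<dots> = Poly_Mapping.single 0 c * list_deriv h (letters u) *
          (Poly_Mapping.single 0 c' * Poly_Mapping.single (Word (letters v)) 1)
        + Poly_Mapping.single 0 c * Poly_Mapping.single (Word (letters u)) 1 *
          (Poly_Mapping.single 0 c' * list_deriv h (letters v))"
        by (simp only: distrib_left mult.assoc)
          (metis (no_types, lifting) mult.assoc single_0_central)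
      finally show ?case
        by (simp add: free_deriv_def lin_ext_single mult_single)
    qed (simp add: distrib_left add)
  qed (simp add: distrib_right add)
qed

lemma free_deriv_gen: "free_deriv h (gen x) = gen (h x)"
  by (simp add: free_deriv_def gen_def lin_ext_single single_Word_Nil)

lemma free_deriv_funpow_gen: "(free_deriv h ^^ m) (gen x) = gen ((h ^^ m) x)"
  by (induction m) (simp_all add: free_deriv_gen)

context
  fixes scale :: "'k::field \<Rightarrow> 'g::ab_group_add \<Rightarrow> 'g"
    and br tri :: "'g \<Rightarrow> 'g \<Rightarrow> 'g"
    and utri :: "('g word \<Rightarrow>\<^sub>0 'k) set \<Rightarrow> ('g word \<Rightarrow>\<^sub>0 'k) set \<Rightarrow> ('g word \<Rightarrow>\<^sub>0 'k) set"
  assumes ext: "post_lie_extension scale br tri utri"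
begin

interpretation U: ring "uenv scale br"
  by (rule ring_uenv)

private abbreviation (input) "U \<equiv> uenv scale br"
private abbreviation (input) "i \<equiv> uincl scale br"
private abbreviation (input) "cl \<equiv> uclass scale br"

private lemma bilinear:
  assumes "E \<in> carrier U" "F \<in> carrier U"
  shows "utri E F \<in> carrier U"
    and "E' \<in> carrier U \<Longrightarrow> utri (E \<oplus>\<^bsub>U\<^esub> E') F = utri E F \<oplus>\<^bsub>U\<^esub> utri E' F"
    and "F' \<in> carrier U \<Longrightarrow> utri E (F \<oplus>\<^bsub>U\<^esub> F') = utri E F \<oplus>\<^bsub>U\<^esub> utri E F'"
    and "utri (uscale scale br c E) F = uscale scale br c (utri E F)"
    and "utri E (uscale scale br c F) = uscale scale br c (utri E F)"
  using ext assms unfolding post_lie_extension_def u_bilinear_def Let_def by auto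

private lemma uscale_mult:
  assumes "E \<in> carrier U" "F \<in> carrier U"
  shows "uscale scale br c E \<otimes>\<^bsub>U\<^esub> F = uscale scale br c (E \<otimes>\<^bsub>U\<^esub> F)"
    and "E \<otimes>\<^bsub>U\<^esub> uscale scale br c F = uscale scale br c (E \<otimes>\<^bsub>U\<^esub> F)"
proof -
  from assms obtain s t where st: "E = cl s" "F = cl t" by (auto simp: carrier_uenv)
  show "uscale scale br c E \<otimes>\<^bsub>U\<^esub> F = uscale scale br c (E \<otimes>\<^bsub>U\<^esub> F)"
    and "E \<otimes>\<^bsub>U\<^esub> uscale scale br c F = uscale scale br c (E \<otimes>\<^bsub>U\<^esub> F)"
    unfolding st uscale_uclass uclass_mult[symmetric]
    by (simp_all add: single_0_central mult.assoc flip: mult.assoc[of s])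
qed

private lemma utri_one: "F \<in> carrier U \<Longrightarrow> utri \<one>\<^bsub>U\<^esub> F = F"
  using ext by (simp add: post_lie_extension_def Let_def)

text \<open>The terms \<open>x \<otimes> 1\<close> and \<open>1 \<otimes> x\<close> of the coproduct
  contribute \<open>utri (i x) F\<close> on the right and \<open>i x\<close> times \<open>F\<close>
  on the left, respectively with \<open>\<one>\<close> in the other slot.\<close>

lemma star_uincl:
  assumes F: "F \<in> carrier U"
  shows "star scale br utri (i x) F = i x \<otimes>\<^bsub>U\<^esub> F \<oplus>\<^bsub>U\<^esub> utri (i x) F"
proof -
  have "u_bilinear scale br (\<lambda>E1 E2. E1 \<otimes>\<^bsub>U\<^esub> utri E2 F)"
    unfolding u_bilinear_def Let_def using F
    by (simp add: bilinear uscale_mult U.l_distr U.r_distr)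
  from sweedler_uincl[OF this, of x] show ?thesis
    using F by (simp add: star_def utri_one uincl_closed bilinear)
qed

text \<open>Primitivity of \<open>x\<close> turns the product rule of the extension into the Leibniz
  rule.\<close>

lemma utri_uincl_mult:
  assumes F: "F1 \<in> carrier U" "F2 \<in> carrier U"
  shows "utri (i x) (F1 \<otimes>\<^bsub>U\<^esub> F2) = utri (i x) F1 \<otimes>\<^bsub>U\<^esub> F2 \<oplus>\<^bsub>U\<^esub> F1 \<otimes>\<^bsub>U\<^esub> utri (i x) F2"
proof -
  have "u_bilinear scale br (\<lambda>E1 E2. utri E1 F1 \<otimes>\<^bsub>U\<^esub> utri E2 F2)"
    unfolding u_bilinear_def Let_def using F
    by (simp add: bilinear uscale_mult U.l_distr U.r_distr)
  from sweedler_uincl[OF this, of x] show ?thesis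
    using F ext uincl_closed[of scale br x] by (simp add: post_lie_extension_def Let_def utri_one)
qed

text \<open>Both sides obey the Leibniz rule and agree on letters, and \<open>utri (i x)\<close>
  kills the unit because the counit of \<open>x\<close> is \<open>0\<close>. Thus
  \<open>free_deriv\<close> lifts the action of \<open>x\<close>.\<close>

lemma uclass_free_deriv: "cl (free_deriv (tri x) t) = utri (i x) (cl t)"
proof -
  have base: "utri (i x) \<one>\<^bsub>U\<^esub> = \<zero>\<^bsub>U\<^esub>" "utri (i x) (i y) = i (tri x y)" for y
    using ext uincl_closed[of scale br x]
    by (simp_all add: post_lie_extension_def Let_def counit_uincl uscale_def uclass_zero)
  have list: "cl (list_deriv (tri x) xs) = utri (i x) (cl (Poly_Mapping.single (Word xs) 1))" for xs
  proof (induction xs)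
    case Nil
    then show ?case by (simp add: single_Word_Nil uclass_one uclass_zero base)
  next
    case (Cons y xs)
    have "cl (list_deriv (tri x) (y # xs)) = i (tri x y) \<otimes>\<^bsub>U\<^esub> cl (Poly_Mapping.single (Word xs) 1)
        \<oplus>\<^bsub>U\<^esub> i y \<otimes>\<^bsub>U\<^esub> utri (i x) (cl (Poly_Mapping.single (Word xs) 1))"
      by (simp add: uclass_add uclass_mult Cons uincl_def)
    also have "\<dots> = utri (i x) (i y \<otimes>\<^bsub>U\<^esub> cl (Poly_Mapping.single (Word xs) 1))"
      by (simp add: utri_uincl_mult uincl_closed uclass_closed base)
    finally show ?case by (simp add: single_Word_Cons uclass_mult uincl_def)
  qed
  show ?thesis
  proof (induction t rule: poly_mapping_add_induct)
    case (1 w c)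
    have "cl (free_deriv (tri x) (Poly_Mapping.single w c))
        = uscale scale br c (utri (i x) (cl (Poly_Mapping.single w 1)))"
      using list[of "letters w"] by (simp add: free_deriv_def lin_ext_single flip: uscale_uclass)
    also have "\<dots> = utri (i x) (uscale scale br c (cl (Poly_Mapping.single w 1)))"
      by (simp add: bilinear uincl_closed uclass_closed)
    finally show ?case by (simp add: uscale_uclass mult_single)
  next
    case (2 s t)
    then show ?case
      by (simp add: free_deriv_def lin_ext_add uclass_add bilinear uincl_closed uclass_closed)
  qed
qed

lemma star_pow_uincl: "star_pow scale br utri (i x) m = cl (deriv_pow (free_deriv (tri x)) (gen x) m)"
proof (induction m)
  case 0
  then show ?case by (simp add: star_pow_def deriv_pow_0 uclass_one)
next
  case (Suc m)
  then show ?case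
    by (simp add: star_pow_def star_uincl uclass_closed deriv_pow_Suc uclass_add uclass_mult
        uclass_free_deriv flip: uincl_def)
qed

text \<open>Commutators of classes of letters are Lie brackets, and \<open>D^(l-1)\<close> sends the
  letter \<open>x\<close> to the letter of its bullet power of order \<open>l\<close>.\<close>

lemma uclass_iter_comm:
  assumes "ls \<noteq> []"
  shows "cl (iter_comm (free_deriv (tri x)) (gen x) ls) = i (iter_br br (map (bullet_pow tri x) ls))"
  using assms
proof (induction ls rule: list_nonempty_induct)
  case (single l)
  then show ?case by (simp add: free_deriv_funpow_gen bullet_pow_def uincl_def)
next
  case (cons l ls)
  then show ?case
    by (simp add: iter_br_Cons uincl_br comm_br_def uclass_diff uclass_mult free_deriv_funpow_gen
        bullet_pow_def flip: uincl_def)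
qed

end

section \<open>Index set and coefficients of the formula\<close>

text \<open>For positive parts, some part is at least \<open>2\<close> exactly when there are fewer
  than \<open>p\<close> parts. The index set thus omits the degrees \<open>1\<close> and
  \<open>p\<close>, which give the bullet power and the ordinary power.\<close>

lemma L_index_eq: "L_index p = (\<Union>n\<in>{2..<p}. compositions n p)"
proof -
  have *: "length ls < sum_list ls \<longleftrightarrow> (\<exists>l\<in>set ls. l \<ge> 2)" if "\<forall>l\<in>set ls. l \<ge> 1" for ls :: "nat list"
  proof -
    have "length ls \<le> sum_list ls \<and> (length ls < sum_list ls \<longleftrightarrow> (\<exists>l\<in>set ls. l \<ge> 2))"
      using that by (induction ls) fastforce+
    then show ?thesis by blast
  qed
  show ?thesis
    using * by (auto simp: L_index_def compositions_def)
qed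

text \<open>All partial sums and factorials in the denominator involve only numbers below
  \<open>p\<close>, hence are invertible, and \<open>bell_coeff_fact\<close> can be divided by
  them.\<close>

lemma L_coeff_eq:
  assumes p: "CHAR('k::field) = p" "prime p" and ls: "ls \<in> compositions n p" "n \<ge> 1"
  shows "L_coeff p ls = (1 / of_nat n * of_nat (bell_coeff ls) :: 'k)"
proof -
  have len: "length ls = n" and sum: "sum_list ls = p" and pos: "\<forall>l\<in>set ls. l \<ge> 1"
    using ls by (auto simp: compositions_def)
  have nz: "of_nat m \<noteq> (0::'k)" if "0 < m" "m < p" for m
    using that p by (auto simp: of_nat_eq_0_iff_char_dvd dest: dvd_imp_le)
  let ?P = "prod_list (map (\<lambda>l. of_nat (fact (l - 1)) :: 'k) ls)"
  have fact_nz: "of_nat (fact m) \<noteq> (0::'k)" if "m < p" for m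
    using that p by (auto simp: of_nat_eq_0_iff_char_dvd prime_dvd_fact_iff)
  have "?P \<noteq> 0"
  proof -
    have "l - 1 < p" if "l \<in> set ls" for l
      using member_le_sum_list[OF that] pos that sum by fastforce
    with fact_nz show ?thesis by (auto simp: prod_list_zero_iff simp del: of_nat_fact)
  qed
  moreover have "C_coeff ls \<noteq> (0::'k)"
  proof -
    \<comment> \<open>A nonempty proper prefix contains the first part and leaves out a later one,
      both positive.\<close>
    have "0 < sum_list (take v ls) \<and> sum_list (take v ls) < p" if v: "v \<in> {1..length ls - 1}" for v
    proof -
      obtain u us where "drop v ls = u # us" using v by (cases "drop v ls") auto
      moreover from this have "u \<in> set ls" by (metis in_set_dropD list.set_intros(1))
      moreover have "hd ls \<in> set ls" "take v ls = hd ls # take (v - 1) (tl ls)"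
        using v by (cases ls; cases v; simp)+
      moreover have "sum_list (take v ls) + sum_list (drop v ls) = p"
        using sum by (metis append_take_drop_id sum_list_append)
      ultimately show ?thesis using pos by force
    qed
    then show ?thesis using nz by (simp add: C_coeff_def)
  qed
  moreover have "of_nat (bell_coeff ls) * C_coeff ls * ?P = (of_nat (fact (p - 1)) :: 'k)"
  proof -
    have "of_nat (prod_list (map (\<lambda>l. fact (l - 1)) xs)) = prod_list (map (\<lambda>l. of_nat (fact (l - 1)) :: 'k) xs)"
      for xs by (induction xs) simp_all
    moreover have "ls \<noteq> []" using ls(2) len by auto
    ultimately show ?thesis
      using arg_cong[OF bell_coeff_fact[of ls], of "of_nat :: nat \<Rightarrow> 'k"] pos
      by (simp add: sum C_coeff_def)
  qed
  ultimately show ?thesis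
    by (simp add: L_coeff_def len divide_simps) (simp add: mult_ac)
qed

section \<open>The formula for \<open>L(x)\<close> and membership in the derived algebra\<close>

theorem theorem2p2p1:
  fixes scale :: "'k::field \<Rightarrow> 'g::ab_group_add \<Rightarrow> 'g"
    and br tri :: "'g \<Rightarrow> 'g \<Rightarrow> 'g"
    and utri :: "('g word \<Rightarrow>\<^sub>0 'k) set \<Rightarrow> ('g word \<Rightarrow>\<^sub>0 'k) set \<Rightarrow> ('g word \<Rightarrow>\<^sub>0 'k) set"
    and p :: nat and x :: 'g
  assumes "CHAR('k) = p" and "p > 0"
    and "post_lie_algebra scale br tri"
    and "post_lie_extension scale br tri utri"
  shows "L_elem scale br tri utri p x \<in> uincl scale br ` lie_derived scale br \<and>
    L_elem scale br tri utri p x =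
      uincl scale br (\<Sum>ls\<in>L_index p. scale (L_coeff p ls) (iter_br br (map (bullet_pow tri x) ls)))"
proof -
  interpret post_lie_algebra scale br tri by fact
  let ?D = "free_deriv (tri x) :: ('g word \<Rightarrow>\<^sub>0 'k) \<Rightarrow> ('g word \<Rightarrow>\<^sub>0 'k)"
  let ?cl = "uclass scale br" and ?g = "gen x :: 'g word \<Rightarrow>\<^sub>0 'k"
  interpret D: ring_derivation ?D by (rule ring_derivation_free_deriv)
  interpret U: ring "uenv scale br" by (rule ring_uenv)
  note ext = \<open>post_lie_extension scale br tri utri\<close>
  have p: "prime p"
    using assms(1,2) prime_CHAR_semidom[where ?'a = 'k] by simp
  have "of_nat p = (0 :: 'g word \<Rightarrow>\<^sub>0 'k)"
    using of_nat_CHAR[where ?'a = 'k] assms(1) by (metis single_of_nat single_zero)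
  from D.deriv_pow_char[OF p this, of ?g] obtain y where
    y: "\<And>n. of_nat n * y n = bell_sum n p (iter_comm ?D ?g)" and
    pow: "deriv_pow ?D ?g p = ?g ^ p + (?D ^^ (p - 1)) ?g + (\<Sum>n=2..<p. y n)"
    by blast
  define z where "z ls = scale (L_coeff p ls) (iter_br br (map (bullet_pow tri x) ls))" for ls
  have cl_y: "?cl (y n) = uincl scale br (\<Sum>ls\<in>compositions n p. z ls)" if n: "n \<in> {2..<p}" for n
  proof -
    \<comment> \<open>Here \<open>0 < n < p\<close> permits the division by \<open>n\<close> over
      the field.\<close>
    have "of_nat n \<noteq> (0::'k)"
      using n assms(1) by (auto simp: of_nat_eq_0_iff_char_dvd dest: dvd_imp_le)
    then have "y n = Poly_Mapping.single 0 (1 / of_nat n) * (of_nat n * y n)"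
      by (simp add: mult_single flip: mult.assoc single_of_nat)
    also have "\<dots> = (\<Sum>ls\<in>compositions n p. Poly_Mapping.single 0 (1 / of_nat n * of_nat (bell_coeff ls))
        * iter_comm ?D ?g ls)"
      unfolding y bell_sum_def sum_distrib_left
      by (intro sum.cong refl) (simp add: mult_single flip: mult.assoc single_of_nat)
    also have "\<dots> = (\<Sum>ls\<in>compositions n p. Poly_Mapping.single 0 (L_coeff p ls) * iter_comm ?D ?g ls)"
      using n by (intro sum.cong refl) (simp add: L_coeff_eq[OF assms(1) p])
    finally have "?cl (y n) = (\<Oplus>\<^bsub>uenv scale br\<^esub>ls\<in>compositions n p.
        uscale scale br (L_coeff p ls) (?cl (iter_comm ?D ?g ls)))"
      by (simp add: uclass_sum finite_compositions uscale_uclass)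
    also have "\<dots> = (\<Oplus>\<^bsub>uenv scale br\<^esub>ls\<in>compositions n p. uincl scale br (z ls))"
    proof (intro U.finsum_cong' refl)
      fix ls assume "ls \<in> compositions n p"
      with n have "ls \<noteq> []" by (auto simp: compositions_def)
      then show "uscale scale br (L_coeff p ls) (?cl (iter_comm ?D ?g ls)) = uincl scale br (z ls)"
        unfolding z_def uincl_scale by (simp only: uclass_iter_comm[OF ext] simp_thms)
    qed (auto simp: uincl_closed)
    finally show ?thesis by (simp add: uincl_sum finite_compositions)
  qed
  have "uincl scale br (\<Sum>ls\<in>L_index p. z ls) = uincl scale br (\<Sum>n=2..<p. \<Sum>ls\<in>compositions n p. z ls)"
    unfolding L_index_eq
    by (subst sum.UNION_disjoint) (simp_all add: finite_compositions, auto simp: compositions_def)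
  also have "\<dots> = (\<Oplus>\<^bsub>uenv scale br\<^esub>n\<in>{2..<p}. ?cl (y n))"
    by (subst uincl_sum, simp, intro U.finsum_cong') (auto simp: cl_y uincl_closed)
  also have "\<dots> = ?cl (\<Sum>n=2..<p. y n)"
    by (simp add: uclass_sum)
  also have "(\<Sum>n=2..<p. y n) = deriv_pow ?D ?g p - ?g ^ p - gen (bullet_pow tri x p)"
    using pow by (simp add: free_deriv_funpow_gen bullet_pow_def)
  also have "?cl \<dots> = L_elem scale br tri utri p x"
    unfolding L_elem_def star_pow_uincl[OF ext] by (simp add: uclass_diff uclass_power uincl_def)
  finally have L: "L_elem scale br tri utri p x = uincl scale br (\<Sum>ls\<in>L_index p. z ls)" ..
  have "z ls \<in> lie_derived scale br" if "ls \<in> L_index p" for ls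
  proof -
    \<comment> \<open>An index has at least two parts, so its iterated bracket has an outermost
      \<open>br\<close>.\<close>
    from that obtain l l' us where "ls = l # l' # us"
      by (auto simp: L_index_def numeral_2_eq_2 Suc_le_length_iff)
    then show ?thesis
      unfolding z_def lie_derived_def by (intro span_scale span_base) auto
  qed
  then have "(\<Sum>ls\<in>L_index p. z ls) \<in> lie_derived scale br"
    unfolding lie_derived_def by (rule span_sum)
  with L show ?thesis by (simp add: z_def)
qed

end
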